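(* Let $R$ be a commutative ring with unity that has at least one nontrivial idempotent and such that $\mathrm{Cl}(R)$ is finite. Then: (i) If $|U(R)|=1$, then $\mathrm{sdim}(\mathrm{Cl}(R))=\mathrm{sdim}(\mathrm{Cl}_2(R))+1$. (ii) If $|U(R)|\ge 2$ and $U''(R)=\emptyset$, then $\mathrm{sdim}(\mathrm{Cl}(R))=\mathrm{sdim}(\mathrm{Cl}_2(R))+|U(R)|-1$. (iii) If $|U''(R)|=2$, then $\mathrm{sdim}(\mathrm{Cl}(R))=\mathrm{sdim}(\mathrm{Cl}_2(R))+|U(R)|$. (iv) If $|U''(R)|>2$ and $\max\{2|\mathrm{Id}_\perp(R)^*|,|\mathrm{Id}(R)^*|\}=|\mathrm{Id}(R)^*|$, then $\mathrm{sdim}(\mathrm{Cl}(R))=\mathrm{sdim}(\mathrm{Cl}_2(R))+|U(R)|$. (v) If $|U''(R)|>2$ and $\max\{2|\mathrm{Id}_\perp(R)^*|,|\mathrm{Id}(R)^*|\}=2|\mathrm{Id}_\perp(R)^*|$, then $\mathrm{sdim}(\mathrm{Cl}(R))=\mathrm{sdim}(\mathrm{Cl}_2(R))+|U(R)|+1$.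
   Context: All rings are commutative with unity. $U(R)$ is the set of units, $\mathrm{Id}(R)$ the set of idempotents, $\mathrm{Id}(R)^*=\mathrm{Id}(R)\setminus\{0,1\}$; $\mathrm{Id}_\perp(R)$ denotes a set of pairwise orthogonal idempotents ($ef=0$ for distinct members) of maximum cardinality and $\mathrm{Id}_\perp(R)^*=\mathrm{Id}_\perp(R)\setminus\{0\}$. $U'(R)=\{u\in U(R):u^2=1\}$, $U''(R)=U(R)\setminus U'(R)$. The clean graph $\mathrm{Cl}(R)$ has vertex set $\{(e,u): e\in\mathrm{Id}(R), u\in U(R)\}$, two distinct vertices $(e,u),(f,v)$ being adjacent iff $ef=0$ or $uv=1$; $\mathrm{Cl}_2(R)$ is its subgraph induced by the vertices with $e\neq 0$. In a graph, a vertex $w$ strongly resolves vertices $x,y$ if some shortest $x$–$w$ path contains $y$ or some shortest $y$–$w$ path contains $x$; a strong resolving set is a set $S$ of vertices such that every two distinct vertices are strongly resolved by some vertex of $S$; $\mathrm{sdim}$ is the smallest cardinality of a strong resolving set.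
   Formalization: Part (v) is stated only when the maximum is not also equal to |Id(R)^*|: if 2|Id_⊥(R)^*| = |Id(R)^*|, as for Z_7×Z_2×Z_2, parts (iv) and (v) contradict each other as worded, and (iv) gives the correct value. *)

theory Defs
  imports "Graph_Theory.Graph_Theory"
begin

definition idempotents :: "'a::comm_ring_1 set" where
  "idempotents = {e. e * e = e}"

definition nontrivial_idempotents :: "'a::comm_ring_1 set" where
  "nontrivial_idempotents = idempotents - {0, 1}"

definition ring_units :: "'a::comm_ring_1 set" where
  "ring_units = {u. u dvd 1}"

definition involutive_units :: "'a::comm_ring_1 set" where
  "involutive_units = {u \<in> ring_units. u ^ 2 = 1}"

definition noninvolutive_units :: "'a::comm_ring_1 set" where
  "noninvolutive_units = ring_units - involutive_units"

definition orthogonal_idempotents :: "'a::comm_ring_1 set \<Rightarrow> bool" where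
  "orthogonal_idempotents P \<longleftrightarrow>
     P \<subseteq> idempotents \<and> pairwise (\<lambda>e f. e * f = 0) P"

text \<open>
  Orthogonality is only required of distinct members, so a set of maximum cardinality
  always contains 0.
\<close>

definition maximum_orthogonal_idempotents :: "'a::comm_ring_1 set \<Rightarrow> bool" where
  "maximum_orthogonal_idempotents P \<longleftrightarrow>
     orthogonal_idempotents P \<and> finite P \<and>
     (\<forall>Q :: 'a set. orthogonal_idempotents Q \<longrightarrow> finite Q \<and> card Q \<le> card P)"

text \<open>
  A simple undirected graph is represented by the loop-free digraph that has both
  arcs \<open>(x, y)\<close> and \<open>(y, x)\<close> for every edge.
\<close>

definition clean_graph :: "('a::comm_ring_1 \<times> 'a, ('a \<times> 'a) \<times> ('a \<times> 'a)) pre_digraph" where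
  "clean_graph =
     \<lparr> verts = idempotents \<times> ring_units,
       arcs = {((e, u), (f, v)) | e u f v.
                 (e, u) \<in> idempotents \<times> ring_units \<and> (f, v) \<in> idempotents \<times> ring_units \<and>
                 (e, u) \<noteq> (f, v) \<and> (e * f = 0 \<or> u * v = 1)},
       tail = fst, head = snd \<rparr>"

definition clean_graph_2 :: "('a::comm_ring_1 \<times> 'a, ('a \<times> 'a) \<times> ('a \<times> 'a)) pre_digraph" where
  "clean_graph_2 = clean_graph \<restriction> {(e, u) \<in> verts clean_graph. e \<noteq> 0}"

lemma graph_clean_graph:
  assumes "finite (verts (clean_graph :: ('a::comm_ring_1 \<times> 'a, _) pre_digraph))"
  shows "graph (clean_graph :: ('a \<times> 'a, _) pre_digraph)"
proof -
  let ?G = "clean_graph :: ('a \<times> 'a, _) pre_digraph"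
  have sub: "arcs ?G \<subseteq> verts ?G \<times> verts ?G"
    by (auto simp: clean_graph_def)
  then have "finite (arcs ?G)"
    using assms by (meson finite_SigmaI finite_subset)
  then show ?thesis
    using assms
    by unfold_locales
      (auto simp: clean_graph_def arc_to_ends_def symmetric_conv mult.commute)
qed

definition shortest_path :: "('v, 'e) pre_digraph \<Rightarrow> 'v \<Rightarrow> 'v list \<Rightarrow> 'v \<Rightarrow> bool" where
  "shortest_path G x p y \<longleftrightarrow>
     vpath p G \<and> hd p = x \<and> last p = y \<and>
     (\<forall>q. vpath q G \<and> hd q = x \<and> last q = y \<longrightarrow> vwalk_length p \<le> vwalk_length q)"

definition strongly_resolves :: "('v, 'e) pre_digraph \<Rightarrow> 'v \<Rightarrow> 'v \<Rightarrow> 'v \<Rightarrow> bool" where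
  "strongly_resolves G w x y \<longleftrightarrow>
     (\<exists>p. shortest_path G x p w \<and> y \<in> set p) \<or> (\<exists>p. shortest_path G y p w \<and> x \<in> set p)"

definition strong_resolving_set :: "('v, 'e) pre_digraph \<Rightarrow> 'v set \<Rightarrow> bool" where
  "strong_resolving_set G S \<longleftrightarrow>
     S \<subseteq> verts G \<and>
     (\<forall>x \<in> verts G. \<forall>y \<in> verts G. x \<noteq> y \<longrightarrow> (\<exists>w \<in> S. strongly_resolves G w x y))"

definition sdim :: "('v, 'e) pre_digraph \<Rightarrow> nat" where
  "sdim G = (LEAST k. \<exists>S. strong_resolving_set G S \<and> finite S \<and> card S = k)"

end

theory Submission
  imports Defs
begin

text \<open>
  By Oellermann and Peters-Fransen, the strong metric dimension of a connected graph is the number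
  of vertices minus the largest number of vertices no two of which are mutually maximally distant.
  If the ring has at least two units, the clean graph has diameter 2 and its only true twins are the
  universal vertices \<open>(0, u)\<close>, so that this largest number is one more than the clique
  number of \<open>Cl\<^sub>2\<close>. The graph \<open>Cl\<^sub>2\<close> itself has no true twins and has diameter 3, the distance 3
  being attained exactly between nonadjacent vertices \<open>(1, u)\<close> and \<open>(1, v)\<close>; there a large
  set may contain \<open>(1, u)\<close> and \<open>(1, u\<inverse>)\<close> together with a clique that avoids the two units.
  Cliques over the nontrivial idempotents have at most \<open>max m (2 N)\<close> elements, where \<open>m\<close> counts
  nontrivial idempotents and \<open>N\<close> is the maximal number of nonzero orthogonal ones: the idempotents
  paired with involutive units annihilate two orthogonal families, one for each choice
  between \<open>u\<close> and \<open>u\<inverse>\<close> in the noninvolutive units.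
\<close>

subsection \<open>Strong resolving sets and mutually maximally distant vertices\<close>

text \<open>The metric enters as an explicit function with local constraints: an arc raises it by at
  most one, and every vertex other than the source has a neighbour one step closer. With natural
  values this forces connectedness and makes \<open>d\<close> the path metric, so a closed formula
  for \<open>d\<close> can be used without handling paths.\<close>

locale graph_distance = pseudo_graph G
  for G :: "('v, 'e) pre_digraph" (structure) +
  fixes d :: "'v \<Rightarrow> 'v \<Rightarrow> nat"
  assumes d_refl: "x \<in> verts G \<Longrightarrow> d x x = 0"
    and d_step: "x \<in> verts G \<Longrightarrow> y \<rightarrow>\<^bsub>G\<^esub> z \<Longrightarrow> d x z \<le> d x y + 1"
    and d_pred: "x \<in> verts G \<Longrightarrow> y \<in> verts G \<Longrightarrow> x \<noteq> y \<Longrightarrow> \<exists>z. z \<rightarrow>\<^bsub>G\<^esub> y \<and> d x z + 1 = d x y"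
begin

lemma adj_sym: "x \<rightarrow>\<^bsub>G\<^esub> y \<Longrightarrow> y \<rightarrow>\<^bsub>G\<^esub> x"
  by (rule arcs_ends_symmetric[OF sym_arcs])

lemma d_eq_0_iff: "x \<in> verts G \<Longrightarrow> y \<in> verts G \<Longrightarrow> d x y = 0 \<longleftrightarrow> x = y"
  using d_refl d_pred by fastforce

text \<open>Induction walks back from \<open>z\<close> towards \<open>y\<close>: the neighbour given
  by \<open>d_pred\<close> is one step closer to \<open>y\<close>, and \<open>d_step\<close> bounds
  the change of the distance from \<open>x\<close>.\<close>

lemma d_triangle:
  assumes "x \<in> verts G" "y \<in> verts G" "z \<in> verts G"
  shows "d x z \<le> d x y + d y z"
  using assms
proof (induction "d y z" arbitrary: z)
  case 0
  then show ?case using d_eq_0_iff by auto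
next
  case (Suc n)
  then have "y \<noteq> z" using d_refl by force
  then obtain w where w: "w \<rightarrow>\<^bsub>G\<^esub> z" "d y w + 1 = d y z"
    using d_pred Suc.prems by blast
  then have "d x w \<le> d x y + d y w"
    using Suc adj_in_verts by (metis Suc_eq_plus1 add_right_cancel)
  then show ?case using d_step[OF \<open>x \<in> verts G\<close> w(1)] w(2) by linarith
qed

lemma d_adj:
  assumes "x \<rightarrow>\<^bsub>G\<^esub> y" shows "d x y \<le> 1"
  using d_step[OF adj_in_verts(1)[OF assms] assms] d_refl[OF adj_in_verts(1)[OF assms]] by simp

lemma d_sym_le:
  assumes "x \<in> verts G" "y \<in> verts G"
  shows "d y x \<le> d x y"
  using assms
proof (induction "d x y" arbitrary: y)
  case 0
  then show ?case using d_eq_0_iff by auto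
next
  case (Suc n)
  then have "x \<noteq> y" using d_refl by force
  then obtain w where w: "w \<rightarrow>\<^bsub>G\<^esub> y" "d x w + 1 = d x y"
    using d_pred Suc.prems by blast
  then have "d w x \<le> d x w"
    using Suc adj_in_verts by (metis Suc_eq_plus1 add_right_cancel)
  moreover have "d y x \<le> d y w + d w x"
    using d_triangle w(1) Suc.prems adj_in_verts by blast
  ultimately show ?case using d_adj[OF adj_sym[OF w(1)]] w(2) by linarith
qed

lemma d_sym: "x \<in> verts G \<Longrightarrow> y \<in> verts G \<Longrightarrow> d x y = d y x"
  using d_sym_le by (simp add: order_antisym)

lemma d_le_vwalk_length:
  assumes "vwalk p G" shows "d (hd p) (last p) \<le> length p - 1"
proof -
  have "last p \<in> verts G \<and> d (hd p) (last p) \<le> length p - 1"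
    using assms
  proof (induction rule: vwalk_induct)
    case (Base u)
    then show ?case by (simp add: d_refl)
  next
    case (Cons u v es)
    then have "d u (last (v # es)) \<le> d u v + d v (last (v # es))"
      using d_triangle adj_in_verts[OF Cons(1)] by blast
    with Cons.IH d_adj[OF Cons(1)] show ?case by simp
  qed
  then show ?thesis ..
qed

text \<open>A geodesic from \<open>x\<close> to \<open>y\<close> is prolonged vertex by vertex
  towards \<open>w\<close>. The equality of distances makes the distance from \<open>x\<close> grow
  by one at each step, so no vertex is repeated.\<close>

lemma ex_vpath_through:
  assumes "x \<in> verts G" "y \<in> verts G" "w \<in> verts G" "d x w = d x y + d y w"
  shows "\<exists>p. vpath p G \<and> hd p = x \<and> last p = w \<and> length p = Suc (d x w) \<and> y \<in> set p"
proof -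
  \<comment> \<open>\<open>Y\<close> collects vertices that must stay on the path. The bound on
    distances from \<open>x\<close> is the invariant that makes the appended vertex new.\<close>
  have step: "\<exists>p. vpath p G \<and> hd p = x \<and> last p = w \<and> length p = Suc (d x w) \<and> Y \<subseteq> set p
        \<and> (\<forall>z\<in>set p. d x z \<le> d x w)"
    if "vpath p G" "hd p = x" "last p = v" "length p = Suc (d x v)" "Y \<subseteq> set p"
      "\<forall>z\<in>set p. d x z \<le> d x v" "v \<rightarrow>\<^bsub>G\<^esub> w" "d x w = Suc (d x v)" for p v w Y
  proof (intro exI[of _ "p @ [w]"] conjI)
    have "p \<noteq> []" using that(4) by auto
    moreover have "vwalk p G" "distinct p" using that(1) by auto
    moreover have "w \<notin> set p" using that(6,8) by auto
    ultimately show "vpath (p @ [w]) G"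
      using that(3,7) adj_in_verts[OF that(7)] set_vwalk_arcs_snoc[of p w]
      by (auto intro!: vpathI simp: vwalk_def)
  qed (use that in \<open>auto simp: hd_append le_Suc_eq\<close>)
  have from_x: "\<exists>p. vpath p G \<and> hd p = x \<and> last p = y \<and> length p = Suc (d x y) \<and> {y} \<subseteq> set p
        \<and> (\<forall>z\<in>set p. d x z \<le> d x y)"
    using assms(2)
  proof (induction "d x y" arbitrary: y)
    case 0
    then have "x = y" using d_eq_0_iff \<open>x \<in> verts G\<close> by auto
    then show ?case using 0 by (intro exI[of _ "[x]"]) auto
  next
    case (Suc n)
    then have "x \<noteq> y" using d_refl by force
    then obtain v where v: "v \<rightarrow>\<^bsub>G\<^esub> y" "d x v + 1 = d x y"
      using d_pred Suc.prems assms(1) by blast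
    then obtain p where p: "vpath p G" "hd p = x" "last p = v" "length p = Suc (d x v)"
      "\<forall>z\<in>set p. d x z \<le> d x v"
      using Suc.hyps(1)[of v] Suc.hyps(2) adj_in_verts(1)[OF v(1)] by auto
    from step[OF p(1-4) _ p(5) v(1), of "{}"] v(2)
    obtain q where q: "vpath q G" "hd q = x" "last q = y" "length q = Suc (d x y)"
      "\<forall>z\<in>set q. d x z \<le> d x y" by auto
    moreover have "y \<in> set q" using q(3,4) by (metis last_in_set length_0_conv nat.distinct(1))
    ultimately show ?case by auto
  qed
  have "\<exists>p. vpath p G \<and> hd p = x \<and> last p = w \<and> length p = Suc (d x w) \<and> {y} \<subseteq> set p
        \<and> (\<forall>z\<in>set p. d x z \<le> d x w)"
    using assms(3,4)
  proof (induction "d y w" arbitrary: w)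
    case 0
    then have "y = w" using d_eq_0_iff \<open>y \<in> verts G\<close> by auto
    then show ?case using from_x by simp
  next
    case (Suc n)
    then have "y \<noteq> w" using d_refl by force
    then obtain v where v: "v \<rightarrow>\<^bsub>G\<^esub> w" "d y v + 1 = d y w"
      using d_pred Suc.prems assms(2) by blast
    have "d x v = d x y + d y v"
      using d_triangle[of x y v] d_step[OF assms(1) v(1)] v Suc.prems assms(1,2) adj_in_verts(1)[OF v(1)]
      by linarith
    then obtain p where p: "vpath p G" "hd p = x" "last p = v" "length p = Suc (d x v)" "{y} \<subseteq> set p"
      "\<forall>z\<in>set p. d x z \<le> d x v"
      using Suc.hyps(1)[of v] Suc.hyps(2) v(2) adj_in_verts(1)[OF v(1)] by auto
    show ?case
      using step[OF p v(1)] v(2) Suc.prems \<open>d x v = d x y + d y v\<close> by auto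
  qed
  then show ?thesis by auto
qed

text \<open>The successor appears because \<open>length\<close> counts vertices while
  \<open>d\<close> counts arcs.\<close>

lemma shortest_path_iff:
  "shortest_path G x p y \<longleftrightarrow> vpath p G \<and> hd p = x \<and> last p = y \<and> length p = Suc (d x y)"
proof
  assume sp: "shortest_path G x p y"
  then have p: "vpath p G" "hd p = x" "last p = y" "p \<noteq> []" 
    by (auto simp: shortest_path_def vpath_def)
  then have "x \<in> verts G" "y \<in> verts G"
    by (metis hd_in_set last_in_set subsetD vpathE vwalkE)+
  then obtain q where "vpath q G" "hd q = x" "last q = y" "length q = Suc (d x y)"
    using ex_vpath_through[of x y y] d_refl by auto
  then have "length p - 1 \<le> d x y"
    using sp unfolding shortest_path_def vwalk_length_simp by (metis diff_Suc_1)
  moreover have "d x y \<le> length p - 1"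
    using d_le_vwalk_length[of p] p by auto
  moreover have "length p > 0" using p(4) by simp
  ultimately show "vpath p G \<and> hd p = x \<and> last p = y \<and> length p = Suc (d x y)"
    using p by linarith
next
  assume "vpath p G \<and> hd p = x \<and> last p = y \<and> length p = Suc (d x y)"
  then show "shortest_path G x p y"
    using d_le_vwalk_length unfolding shortest_path_def vwalk_length_simp
    by (metis diff_Suc_1 vpath_def)
qed

text \<open>Cutting a shortest path at \<open>y\<close> leaves walks of length at least
  \<open>d x y\<close> and \<open>d y w\<close>; the triangle inequality then leaves only
  equality.\<close>

lemma ex_shortest_path_through_iff:
  assumes "x \<in> verts G" "y \<in> verts G" "w \<in> verts G"
  shows "(\<exists>p. shortest_path G x p w \<and> y \<in> set p) \<longleftrightarrow> d x w = d x y + d y w"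
proof
  assume "\<exists>p. shortest_path G x p w \<and> y \<in> set p"
  then obtain p where p: "vpath p G" "hd p = x" "last p = w" "length p = Suc (d x w)" "y \<in> set p"
    using shortest_path_iff by auto
  then obtain p1 p2 where p12: "p = p1 @ y # p2" by (meson split_list)
  have "vwalk (p1 @ [y]) G" "vwalk (y # p2) G"
    using p(1) p12 vwalkI_append_l[of "p1 @ [y]" p2 G] vwalkI_append_r[of "y # p2" p1 G] by auto
  from this[THEN d_le_vwalk_length] have "d x y \<le> length p1" "d y w \<le> length p2"
    using p(2,3) p12 by (auto simp: hd_append split: if_splits)
  then show "d x w = d x y + d y w"
    using d_triangle[OF assms] p(4) p12 by simp
next
  assume "d x w = d x y + d y w"
  then show "\<exists>p. shortest_path G x p w \<and> y \<in> set p"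
    using ex_vpath_through[OF assms] shortest_path_iff by blast
qed

lemma strongly_resolves_iff:
  assumes "x \<in> verts G" "y \<in> verts G" "w \<in> verts G"
  shows "strongly_resolves G w x y \<longleftrightarrow> d x w = d x y + d y w \<or> d y w = d y x + d x w"
  using assms by (simp only: strongly_resolves_def ex_shortest_path_through_iff)

definition mutually_maximally_distant :: "'v \<Rightarrow> 'v \<Rightarrow> bool" where
  "mutually_maximally_distant x y \<longleftrightarrow>
     (\<forall>z. z \<rightarrow>\<^bsub>G\<^esub> x \<longrightarrow> d z y \<le> d x y) \<and> (\<forall>z. z \<rightarrow>\<^bsub>G\<^esub> y \<longrightarrow> d x z \<le> d x y)"

lemma mmd_sym:
  assumes "x \<in> verts G" "y \<in> verts G" "mutually_maximally_distant x y"
  shows "mutually_maximally_distant y x"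
  using assms adj_in_verts unfolding mutually_maximally_distant_def by (metis d_sym)

text \<open>If \<open>w\<close> differed from \<open>y\<close>, a neighbour of \<open>y\<close>
  closer to \<open>w\<close> would be farther from \<open>x\<close> than \<open>y\<close> is,
  against maximality.\<close>

lemma mmd_resolved:
  assumes "x \<in> verts G" "y \<in> verts G" "w \<in> verts G" "mutually_maximally_distant x y"
    and "d x w = d x y + d y w"
  shows "w = y"
proof (rule ccontr)
  assume "w \<noteq> y"
  then obtain z where z: "z \<rightarrow>\<^bsub>G\<^esub> y" "d w z + 1 = d w y"
    using d_pred assms by blast
  then have zv: "z \<in> verts G" using adj_in_verts by blast
  have "d x z \<le> d x y"
    using z assms(4) unfolding mutually_maximally_distant_def by blast
  moreover have "d x w \<le> d x z + d z w" using d_triangle zv assms by blast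
  ultimately show False using z(2) assms zv by (simp add: d_sym)
qed

text \<open>
  Oellermann and Peters-Fransen: any geodesic extends to one whose end vertices are
  mutually maximally distant, so it suffices to cover those pairs.
\<close>

lemma strong_resolving_set_iff:
  assumes "S \<subseteq> verts G"
  shows "strong_resolving_set G S \<longleftrightarrow>
    (\<forall>x \<in> verts G. \<forall>y \<in> verts G. x \<noteq> y \<and> mutually_maximally_distant x y \<longrightarrow> x \<in> S \<or> y \<in> S)"
    (is "_ \<longleftrightarrow> ?cover")
proof
  assume L: "strong_resolving_set G S"
  show ?cover
  proof (intro ballI impI)
    fix x y assume xy: "x \<in> verts G" "y \<in> verts G" "x \<noteq> y \<and> mutually_maximally_distant x y"
    then obtain w where w: "w \<in> S" "strongly_resolves G w x y"
      using L unfolding strong_resolving_set_def by blast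
    then have "d x w = d x y + d y w \<or> d y w = d y x + d x w"
      using xy assms strongly_resolves_iff by blast
    then show "x \<in> S \<or> y \<in> S"
      using mmd_resolved[of x y w] mmd_resolved[of y x w] mmd_sym w(1) assms xy by blast
  qed
next
  assume R: ?cover
  have "\<exists>w\<in>S. strongly_resolves G w x y" if xy: "x \<in> verts G" "y \<in> verts G" "x \<noteq> y" for x y
  proof -
    \<comment> \<open>Pairs joined by a geodesic that meets \<open>x\<close> and then
      \<open>y\<close>. For a pair in \<open>Q\<close> at maximal distance, a neighbour of one end
      lying farther from the other end would give a longer pair in \<open>Q\<close>.\<close>
    define Q where "Q = {(a, b). a \<in> verts G \<and> b \<in> verts G \<and> d a b = d a x + d x y + d y b}"
    have "Q \<subseteq> verts G \<times> verts G" by (auto simp: Q_def)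
    then have "finite Q" using finite_verts by (meson finite_SigmaI finite_subset)
    moreover have "(x, y) \<in> Q" using xy d_refl by (auto simp: Q_def)
    ultimately obtain q where q: "q \<in> Q" "\<forall>q' \<in> Q. (case q' of (a, b) \<Rightarrow> d a b) \<le> (case q of (a, b) \<Rightarrow> d a b)"
      using obtains_MAX[of Q "\<lambda>(a, b). d a b"] Max_ge[of "(\<lambda>(a, b). d a b) ` Q"]
      by (metis (no_types, lifting) empty_iff finite_imageI image_eqI)
    obtain a b where "q = (a, b)" by fastforce
    with q have ab: "(a, b) \<in> Q" and max: "\<And>a' b'. (a', b') \<in> Q \<Longrightarrow> d a' b' \<le> d a b"
      by auto
    have abV: "a \<in> verts G" "b \<in> verts G" and dab: "d a b = d a x + d x y + d y b"
      using ab by (auto simp: Q_def)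
    have mb: "d a z \<le> d a b" if z: "z \<rightarrow>\<^bsub>G\<^esub> b" for z
    proof (rule ccontr)
      assume "\<not> d a z \<le> d a b"
      moreover have zV: "z \<in> verts G" using adj_in_verts z by blast
      moreover have "d y z \<le> d y b + 1" using d_step adj_sym z xy by blast
      moreover have "d a z \<le> d a x + d x z" "d x z \<le> d x y + d y z"
        using d_triangle zV abV xy by blast+
      ultimately have "(a, z) \<in> Q" using dab abV by (auto simp: Q_def)
      then show False using max \<open>\<not> d a z \<le> d a b\<close> by blast
    qed
    have ma: "d z b \<le> d a b" if z: "z \<rightarrow>\<^bsub>G\<^esub> a" for z
    proof (rule ccontr)
      assume *: "\<not> d z b \<le> d a b"
      have zV: "z \<in> verts G" using adj_in_verts z by blast
      have "d z a \<le> 1" using d_adj z by blast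
      moreover have "d z b \<le> d z x + d x b" "d x b \<le> d x y + d y b" "d z x \<le> d z a + d a x"
        using d_triangle zV abV xy by blast+
      ultimately have "(z, b) \<in> Q" using dab abV zV * by (auto simp: Q_def)
      then show False using max * by blast
    qed
    have "mutually_maximally_distant a b"
      using ma mb unfolding mutually_maximally_distant_def by blast
    moreover have "a \<noteq> b" using dab d_refl[of a] abV d_eq_0_iff[of x y] xy by auto
    \<comment> \<open>Either end of the long geodesic resolves \<open>x\<close> and
      \<open>y\<close>, since both lie on it.\<close>
    ultimately consider "a \<in> S" | "b \<in> S" using R abV by blast
    then show ?thesis
    proof cases
      case 1
      have "d a y \<le> d a x + d x y" "d a b \<le> d a y + d y b"
        using d_triangle abV xy by blast+
      then have "d a y = d a x + d x y" using dab by linarith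
      then have "d y a = d y x + d x a" using d_sym abV xy by (metis add.commute)
      then show ?thesis using 1 xy abV strongly_resolves_iff by blast
    next
      case 2
      have "d x b \<le> d x y + d y b" "d a b \<le> d a x + d x b"
        using d_triangle abV xy by blast+
      then have "d x b = d x y + d y b" using dab by linarith
      then show ?thesis using 2 xy abV strongly_resolves_iff by blast
    qed
  qed
  then show "strong_resolving_set G S" using assms unfolding strong_resolving_set_def by blast
qed

text \<open>These are the independent sets of the strong resolving graph, whose edges join mutually
  maximally distant vertices; their complements are its vertex covers.\<close>

definition mmd_independent :: "'v set \<Rightarrow> bool" where
  "mmd_independent I \<longleftrightarrow>
     I \<subseteq> verts G \<and> pairwise (\<lambda>x y. \<not> mutually_maximally_distant x y) I"

lemma mmd_independent_iff:
  assumes "\<And>x y. x \<in> verts G \<Longrightarrow> y \<in> verts G \<Longrightarrow> x \<noteq> y \<Longrightarrow>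
    \<not> mutually_maximally_distant x y \<longleftrightarrow> R x y"
  shows "mmd_independent I \<longleftrightarrow> I \<subseteq> verts G \<and> pairwise R I"
  unfolding mmd_independent_def pairwise_def
  by (rule conj_cong[OF refl], intro ball_cong refl imp_cong) (use assms in blast)

lemma mmdI:
  assumes "\<And>z. z \<in> verts G \<Longrightarrow> d z y \<le> d x y" "\<And>z. z \<in> verts G \<Longrightarrow> d x z \<le> d x y"
  shows "mutually_maximally_distant x y"
  unfolding mutually_maximally_distant_def using assms adj_in_verts(1) by simp

lemma strong_resolving_set_compl_iff:
  assumes "I \<subseteq> verts G"
  shows "strong_resolving_set G (verts G - I) \<longleftrightarrow> mmd_independent I"
  using assms by (auto simp: strong_resolving_set_iff mmd_independent_def pairwise_def)

text \<open>This is Gallai's identity between minimum vertex covers and maximum independent sets, in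
  additive form to avoid truncated subtraction.\<close>

lemma sdim_plus_card_independent:
  assumes I: "mmd_independent I"
    and max: "\<And>J. mmd_independent J \<Longrightarrow> card J \<le> card I"
  shows "sdim G + card I = card (verts G)"
proof -
  have sub: "I \<subseteq> verts G" using I by (simp add: mmd_independent_def)
  have card_I: "card I \<le> card (verts G)" by (simp add: sub card_mono)
  have "sdim G = card (verts G) - card I"
    unfolding sdim_def
  proof (rule Least_equality)
    show "\<exists>S. strong_resolving_set G S \<and> finite S \<and> card S = card (verts G) - card I"
      using I sub
      by (intro exI[of _ "verts G - I"])
        (simp add: strong_resolving_set_compl_iff card_Diff_subset finite_subset[OF sub])
  next
    fix k assume "\<exists>S. strong_resolving_set G S \<and> finite S \<and> card S = k"
    then obtain S where S: "strong_resolving_set G S" "card S = k" by blast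
    have "S \<subseteq> verts G" using S(1) by (simp add: strong_resolving_set_def)
    then have "verts G - (verts G - S) = S" by auto
    then have "mmd_independent (verts G - S)"
      using S(1) strong_resolving_set_compl_iff[of "verts G - S"] by simp
    then have "card (verts G - S) \<le> card I" by (rule max)
    then show "card (verts G) - card I \<le> k"
      using \<open>S \<subseteq> verts G\<close> S(2) by (simp add: card_Diff_subset finite_subset)
  qed
  then show ?thesis using card_I by simp
qed

end

section \<open>Graphs of diameter at most two\<close>

text \<open>A common neighbour is the predecessor that \<open>d_pred\<close> asks for. Complete
  graphs are included, as the hypothesis is vacuous for them.\<close>

lemma (in graph) graph_distance_diameter_2:
  assumes "\<And>x y. x \<in> verts G \<Longrightarrow> y \<in> verts G \<Longrightarrow> x \<noteq> y \<Longrightarrow> \<not> x \<rightarrow>\<^bsub>G\<^esub> y \<Longrightarrow>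
    \<exists>z. x \<rightarrow>\<^bsub>G\<^esub> z \<and> z \<rightarrow>\<^bsub>G\<^esub> y"
  shows "graph_distance G (\<lambda>x y. if x = y then 0 else if x \<rightarrow>\<^bsub>G\<^esub> y then 1 else 2)"
proof unfold_locales
  fix x y assume xy: "x \<in> verts G" "y \<in> verts G" "x \<noteq> y"
  let ?d = "\<lambda>x y. if x = y then 0 else if x \<rightarrow>\<^bsub>G\<^esub> y then 1 else 2 :: nat"
  show "\<exists>z. z \<rightarrow>\<^bsub>G\<^esub> y \<and> ?d x z + 1 = ?d x y"
  proof (cases "x \<rightarrow>\<^bsub>G\<^esub> y")
    case True
    then show ?thesis using xy by auto
  next
    case False
    then obtain z where "x \<rightarrow>\<^bsub>G\<^esub> z" "z \<rightarrow>\<^bsub>G\<^esub> y" using assms xy by blast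
    then show ?thesis using xy False adj_not_same by (intro exI[of _ z]) auto
  qed
qed auto

text \<open>Any two distinct vertices are mutually maximally distant, so an independent set has at
  most one element. This serves rings with a single unit.\<close>

lemma (in graph) sdim_complete:
  assumes "verts G \<noteq> {}"
    and complete: "\<And>x y. x \<in> verts G \<Longrightarrow> y \<in> verts G \<Longrightarrow> x \<noteq> y \<Longrightarrow> x \<rightarrow>\<^bsub>G\<^esub> y"
  shows "sdim G + 1 = card (verts G)"
proof -
  define d :: "'a \<Rightarrow> 'a \<Rightarrow> nat"
    where "d = (\<lambda>x y. if x = y then 0 else if x \<rightarrow>\<^bsub>G\<^esub> y then 1 else 2)"
  interpret graph_distance G d
    unfolding d_def using complete by (intro graph_distance_diameter_2) blast
  have mmd: "mutually_maximally_distant x y" if "x \<in> verts G" "y \<in> verts G" "x \<noteq> y" for x y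
    using that complete by (intro mmdI) (auto simp: d_def)
  obtain x where x: "x \<in> verts G" using assms(1) by blast
  have "sdim G + card {x} = card (verts G)"
  proof (rule sdim_plus_card_independent)
    show "mmd_independent {x}" using x by (simp add: mmd_independent_def)
    fix J assume J: "mmd_independent J"
    then have "finite J" using finite_subset[OF _ finite_verts] by (auto simp: mmd_independent_def)
    moreover have "a = b" if "a \<in> J" "b \<in> J" for a b
      using J mmd that unfolding mmd_independent_def pairwise_def by blast
    ultimately show "card J \<le> card {x}" by (simp add: card_le_Suc0_iff_eq)
  qed
  then show ?thesis by simp
qed

subsection \<open>Units and orthogonal idempotents\<close>

lemma ring_unit_has_inverse:
  fixes u :: "'a::comm_ring_1"
  assumes "u \<in> ring_units"
  obtains v where "v \<in> ring_units" "u * v = 1"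
proof -
  from assms obtain v where "1 = u * v" unfolding ring_units_def by blast
  moreover from this have "v dvd 1" by (metis dvd_triv_right)
  ultimately show ?thesis using that by (simp add: ring_units_def)
qed

lemma inverse_unique_comm_ring:
  fixes u v w :: "'a::comm_ring_1"
  assumes "u * v = 1" "u * w = 1"
  shows "v = w"
  using assms by (metis mult.assoc mult.commute mult_1)

lemma one_ring_unit [simp]: "1 \<in> ring_units"
  by (simp add: ring_units_def)

lemma noninvolutive_units_iff:
  "u \<in> noninvolutive_units \<longleftrightarrow> u \<in> ring_units \<and> u * u \<noteq> 1"
  by (auto simp: noninvolutive_units_def involutive_units_def power2_eq_square)

lemma noninvolutive_unit_has_inverse:
  fixes u :: "'a::comm_ring_1"
  assumes "u \<in> noninvolutive_units"
  obtains v where "v \<in> noninvolutive_units" "u * v = 1" "u \<noteq> v"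
proof -
  have u: "u \<in> ring_units" "u * u \<noteq> 1" using assms by (auto simp: noninvolutive_units_iff)
  then obtain v where v: "v \<in> ring_units" "u * v = 1" using ring_unit_has_inverse by blast
  then have "u \<noteq> v" using u by auto
  moreover have "v * v \<noteq> 1"
    using inverse_unique_comm_ring[of v v u] v \<open>u \<noteq> v\<close> by (auto simp: mult.commute)
  ultimately show ?thesis using that v by (simp add: noninvolutive_units_iff)
qed

text \<open>\<open>H\<close> selects one unit from each pair of distinct mutually inverse units, so
  neither \<open>H\<close> nor the rest contains such a pair.\<close>

lemma half_of_noninvolutive_units:
  obtains H :: "'a::comm_ring_1 set" where "H \<subseteq> noninvolutive_units"
    "\<And>u v. u \<in> H \<Longrightarrow> v \<in> H \<Longrightarrow> u * v \<noteq> 1"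
    "\<And>u v. u \<in> noninvolutive_units - H \<Longrightarrow> v \<in> noninvolutive_units - H \<Longrightarrow> u * v \<noteq> 1"
proof -
  \<comment> \<open>The predicate under the choice operator is the same for a unit and its inverse,
    so both get the same representative.\<close>
  define g :: "'a \<Rightarrow> 'a" where "g u = (SOME w. w = u \<or> u * w = 1)" for u
  define H where "H = {u \<in> noninvolutive_units. g u = u}"
  have g: "g u = g v \<and> (g u = u \<or> g u = v)" if "u * v = 1" for u v
  proof -
    have "(w = u \<or> u * w = 1) \<longleftrightarrow> (w = v \<or> v * w = 1)" for w
      using that inverse_unique_comm_ring[of u v w] inverse_unique_comm_ring[of v u w]
      by (auto simp: mult.commute)
    then have "g u = g v" by (simp add: g_def)
    moreover have "g u = u \<or> u * g u = 1"
      unfolding g_def by (rule someI[of _ u]) simp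
    ultimately show ?thesis using that inverse_unique_comm_ring by blast
  qed
  show ?thesis
  proof (rule that[of H])
    show "u * v \<noteq> 1" if "u \<in> H" "v \<in> H" for u v
      using that g[of u v] by (auto simp: H_def noninvolutive_units_iff)
    show "u * v \<noteq> 1" if "u \<in> noninvolutive_units - H" "v \<in> noninvolutive_units - H" for u v
      using that g[of u v] by (auto simp: H_def)
  qed (auto simp: H_def)
qed

text \<open>Distinctness and membership among the vertices are left out, so that both graphs share
  the relation and cliques are the sets satisfying \<open>pairwise clean_adjacent\<close>.\<close>

definition clean_adjacent :: "'a::comm_ring_1 \<times> 'a \<Rightarrow> 'a \<times> 'a \<Rightarrow> bool" where
  "clean_adjacent x y \<longleftrightarrow> fst x * fst y = 0 \<or> snd x * snd y = 1"

lemma clean_adjacent_sym: "clean_adjacent x y \<longleftrightarrow> clean_adjacent y x"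
  by (simp add: clean_adjacent_def mult.commute)

lemma card_idempotents:
  assumes "finite (idempotents :: 'a::comm_ring_1 set)"
  shows "card (idempotents :: 'a set) = card (nontrivial_idempotents :: 'a set) + 2"
proof -
  have "{0, 1} \<subseteq> (idempotents :: 'a set)" by (simp add: idempotents_def)
  then have "card {0, 1 :: 'a} + card (nontrivial_idempotents :: 'a set) = card (idempotents :: 'a set)"
    using assms card_Diff_subset[of "{0, 1 :: 'a}" idempotents] card_mono[OF assms, of "{0, 1}"]
    by (simp add: nontrivial_idempotents_def)
  then show ?thesis by simp
qed

lemma ex_maximum_orthogonal_idempotents:
  assumes "finite (idempotents :: 'a::comm_ring_1 set)"
  obtains P :: "'a::comm_ring_1 set" where "maximum_orthogonal_idempotents P"
proof -
  let ?O = "Collect orthogonal_idempotents :: 'a set set"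
  have "?O \<subseteq> Pow idempotents" by (auto simp: orthogonal_idempotents_def)
  then have fin: "finite ?O" using assms by (meson finite_Pow_iff finite_subset)
  have "{} \<in> ?O" by (simp add: orthogonal_idempotents_def)
  then obtain P where "P \<in> ?O" "card P = Max (card ` ?O)"
    using Max_in[of "card ` ?O"] fin by (metis (no_types, lifting) empty_iff finite_imageI image_iff)
  then have "maximum_orthogonal_idempotents P"
    using fin assms finite_subset unfolding maximum_orthogonal_idempotents_def
    by (auto simp: orthogonal_idempotents_def)
  then show ?thesis using that by blast
qed

text \<open>
  For distinct vertices of \<open>Cl\<^sub>2\<close>, the negation of being mutually maximally distant.
\<close>

definition clean2_compatible :: "'a::comm_ring_1 \<times> 'a \<Rightarrow> 'a \<times> 'a \<Rightarrow> bool" where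
  "clean2_compatible x y \<longleftrightarrow>
     (if fst x = 1 \<and> fst y = 1 then snd x * snd y = 1
      else if fst x = 1 \<or> fst y = 1 then snd x \<noteq> snd y \<or> snd x * snd x = 1
      else clean_adjacent x y)"

section \<open>Upper bounds for cliques and compatible sets\<close>

text \<open>\<open>P\<close> is an arbitrary maximum family, which lets the final statement range
  over all of them.\<close>

locale clean_ring =
  fixes P :: "'a::comm_ring_1 set" and m :: nat
  assumes finite_idempotents: "finite (idempotents :: 'a set)"
    and finite_units: "finite (ring_units :: 'a set)"
    and ex_nontrivial: "(nontrivial_idempotents :: 'a set) \<noteq> {}"
    and maximum_P: "maximum_orthogonal_idempotents P"
    and card_nontrivial: "card (nontrivial_idempotents :: 'a set) = m"
begin

abbreviation "N \<equiv> card (P - {0})"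

lemma finite_nontrivial: "finite (nontrivial_idempotents :: 'a set)"
  using finite_idempotents by (simp add: nontrivial_idempotents_def)

lemma card_le_m: "A \<subseteq> (nontrivial_idempotents :: 'a set) \<Longrightarrow> card A \<le> m"
  using card_mono[OF finite_nontrivial] card_nontrivial by simp

lemma card_nonzero_idempotents: "card (idempotents - {0 :: 'a}) = m + 1"
  using card_idempotents[OF finite_idempotents] finite_idempotents card_nontrivial
  by (simp add: card_Diff_singleton_if idempotents_def)

lemma finite_P: "finite P"
  using maximum_P by (simp add: maximum_orthogonal_idempotents_def)

text \<open>\<open>P\<close> is maximum among families that may contain 0, so \<open>B\<close> is
  compared with it after adjoining 0.\<close>

lemma orthogonal_card_le:
  fixes B :: "'a set"
  assumes "orthogonal_idempotents B" "0 \<notin> B"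
  shows "card B \<le> N"
proof -
  have "orthogonal_idempotents (insert 0 B)"
    using assms(1) by (auto simp: orthogonal_idempotents_def pairwise_insert idempotents_def)
  moreover have "\<forall>Q :: 'a set. orthogonal_idempotents Q \<longrightarrow> finite Q \<and> card Q \<le> card P"
    using maximum_P by (simp add: maximum_orthogonal_idempotents_def)
  ultimately have "finite (insert 0 B) \<and> card (insert 0 B) \<le> card P" by metis
  then have "card B + 1 \<le> card P" using assms(2) by auto
  then show ?thesis using finite_P by (auto simp: card_Diff_singleton_if)
qed

text \<open>A nontrivial idempotent \<open>e\<close> and \<open>1 - e\<close> are
  orthogonal.\<close>

lemma two_le_N: "2 \<le> N"
proof -
  obtain e :: 'a where e: "e * e = e" "e \<noteq> 0" "e \<noteq> 1"
    using ex_nontrivial by (auto simp: nontrivial_idempotents_def idempotents_def)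
  have *: "e * (1 - e) = 0" using e by (simp add: algebra_simps)
  then have "e \<noteq> 1 - e" using e by metis
  have "orthogonal_idempotents {e, 1 - e}"
    using e(1) * by (auto simp: orthogonal_idempotents_def pairwise_insert idempotents_def left_diff_distrib mult.commute)
  then have "card {e, 1 - e} \<le> N" using e by (intro orthogonal_card_le) auto
  then show ?thesis using \<open>e \<noteq> 1 - e\<close> by simp
qed

text \<open>An orthogonal family containing 1 has no other nonzero member, which
  \<open>two_le_N\<close> rules out for \<open>P\<close>.\<close>

lemma P_nontrivial: "P - {0} \<subseteq> nontrivial_idempotents"
proof -
  have orth: "P \<subseteq> idempotents" "pairwise (\<lambda>e f. e * f = 0) P"
    using maximum_P by (auto simp: maximum_orthogonal_idempotents_def orthogonal_idempotents_def)
  have "1 \<notin> P"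
  proof
    assume "1 \<in> P"
    then have "P - {0} \<subseteq> {1}" using orth(2) by (force simp: pairwise_def)
    then have "N \<le> 1" using card_mono[of "{1::'a}"] by fastforce
    then show False using two_le_N by simp
  qed
  then show ?thesis using orth(1) by (auto simp: nontrivial_idempotents_def)
qed

text \<open>If \<open>A\<close> has two elements and \<open>B\<close> is nonempty, a suitable
  translate \<open>a + B\<close> is a third set of nontrivial idempotents, disjoint from
  \<open>A\<close> and \<open>B\<close>, so the left side counts distinct nontrivial idempotents. If
  \<open>A\<close> is a singleton, it extends \<open>B\<close> to a larger orthogonal
  family.\<close>

lemma orthogonal_annihilator_card_le:
  fixes A B :: "'a set"
  assumes A: "A \<subseteq> nontrivial_idempotents" and B: "B \<subseteq> nontrivial_idempotents"
    and orthB: "pairwise (\<lambda>e f. e * f = 0) B"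
    and AB: "\<And>a b. a \<in> A \<Longrightarrow> b \<in> B \<Longrightarrow> a * b = 0"
  shows "card A + 2 * card B \<le> max m (2 * N)"
proof -
  have fin: "finite A" "finite B" using A B finite_nontrivial finite_subset by auto
  have AI: "a * a = a" "a \<noteq> 0" "a \<noteq> 1" if "a \<in> A" for a
    using A that by (auto simp: nontrivial_idempotents_def idempotents_def)
  have BI: "b * b = b" "b \<noteq> 0" "b \<noteq> 1" if "b \<in> B" for b
    using B that by (auto simp: nontrivial_idempotents_def idempotents_def)
  have cB: "card B \<le> N"
    using orthogonal_card_le[of B] B orthB
    by (auto simp: orthogonal_idempotents_def nontrivial_idempotents_def)
  consider "B = {}" | "card A = 0" | "card A = 1" | "B \<noteq> {}" "card A \<ge> 2" by linarith
  then show ?thesis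
  proof cases
    case 1
    then show ?thesis using card_le_m[OF A] by simp
  next
    case 2
    then show ?thesis using cB by simp
  next
    case 3
    then obtain a where a: "A = {a}" by (auto simp: card_1_singleton_iff)
    then have "a \<notin> B" using AB AI by fastforce
    moreover have "card (insert a B) \<le> N"
      using A B orthB a AB
      by (intro orthogonal_card_le)
        (auto simp: orthogonal_idempotents_def nontrivial_idempotents_def pairwise_insert mult.commute)
    ultimately show ?thesis using a fin by simp
  next
    case 4
    then obtain b1 where b1: "b1 \<in> B" by auto
    \<comment> \<open>Avoiding \<open>1 - b1\<close> keeps 1 out of the translate:
      \<open>a + b1\<close> is not 1 by choice, and for any other \<open>b\<close> the sum
      \<open>a + b\<close> annihilates the nonzero \<open>b1\<close>.\<close>
    have "\<not> A \<subseteq> {1 - b1}" using 4(2) card_mono[of "{1 - b1}" A] by auto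
    then obtain a where a: "a \<in> A" "a \<noteq> 1 - b1" by auto
    have sum_b: "(a + b) * b = b" "(a + b) * a = a" if "b \<in> B" for b
      using AB[OF a(1) that] BI[OF that] AI[OF a(1)] by (simp_all add: algebra_simps)
    have C: "(+) a ` B \<subseteq> nontrivial_idempotents"
    proof
      fix c assume "c \<in> (+) a ` B"
      then obtain b where b: "b \<in> B" "c = a + b" by auto
      have "c * c = c" using sum_b[OF b(1)] b(2) by (simp add: distrib_left add.commute)
      moreover have "c \<noteq> 0" using sum_b[OF b(1)] b(2) BI[OF b(1)] by force
      moreover have "c \<noteq> 1"
      proof
        assume c1: "c = 1"
        then have "b \<noteq> b1" using a(2) b(2) by (auto simp: algebra_simps)
        then have "b1 * b = 0" "a * b1 = 0" using orthB b(1) b1 a(1) AB by (auto simp: pairwise_def)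
        then have "(a + b) * b1 = 0" by (simp add: algebra_simps)
        then show False using c1 b(2) BI[OF b1] by simp
      qed
      ultimately show "c \<in> nontrivial_idempotents"
        by (simp add: nontrivial_idempotents_def idempotents_def)
    qed
    \<comment> \<open>A common element would have square 0. Moreover \<open>a + b\<close> does not
      annihilate \<open>b\<close>, as members of \<open>A\<close> do, nor \<open>a\<close>, as
      members of \<open>B\<close> do.\<close>
    have "A \<inter> B = {}" using AB AI by fastforce
    moreover have "a + b \<notin> A" if "b \<in> B" for b
      using AB[of "a + b" b] that sum_b BI by force
    moreover have "a + b \<notin> B" if "b \<in> B" for b
      using AB[of a "a + b"] that sum_b(2)[OF that] AI[OF a(1)] a(1) by (auto simp: mult.commute)
    ultimately have disj: "A \<inter> B = {}" "(A \<union> B) \<inter> (+) a ` B = {}" by auto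
    have "card (A \<union> B \<union> (+) a ` B) = card A + card B + card ((+) a ` B)"
      using disj fin by (simp add: card_Un_disjoint)
    also have "card ((+) a ` B) = card B" by (simp add: card_image)
    finally have "card A + 2 * card B = card (A \<union> B \<union> (+) a ` B)" by simp
    also have "\<dots> \<le> m" using A B C by (intro card_le_m) auto
    finally show ?thesis by simp
  qed
qed

text \<open>Vertices with the same nonzero idempotent are adjacent only through inverse units, and
  an involutive unit is its own inverse; hence each idempotent occurs at most once.\<close>

lemma involutive_clique_card_le:
  fixes K :: "('a \<times> 'a) set"
  assumes K: "K \<subseteq> nontrivial_idempotents \<times> ring_units" "pairwise clean_adjacent K"
    and inv: "\<And>x. x \<in> K \<Longrightarrow> snd x * snd x = 1"
  shows "inj_on fst K" "card K \<le> m"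
proof -
  show inj: "inj_on fst K"
  proof (rule inj_onI)
    fix x y assume xy: "x \<in> K" "y \<in> K" "fst x = fst y"
    have "fst x * fst y \<noteq> 0"
      using xy K(1) by (auto simp: nontrivial_idempotents_def idempotents_def)
    then have "x \<noteq> y \<Longrightarrow> snd x * snd y = 1"
      using K(2) xy unfolding pairwise_def clean_adjacent_def by blast
    then show "x = y" using inv[OF xy(1)] inverse_unique_comm_ring xy(3) by (metis prod.expand)
  qed
  have "card (fst ` K) \<le> m" using K(1) by (intro card_le_m) auto
  then show "card K \<le> m" using inj by (simp add: card_image)
qed

text \<open>Without inverse units every adjacency comes from orthogonality, and a nonzero idempotent
  is not orthogonal to itself.\<close>

lemma orthogonal_clique_card_le:
  fixes K :: "('a \<times> 'a) set"
  assumes K: "K \<subseteq> (idempotents - {0}) \<times> ring_units" "pairwise clean_adjacent K"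
    and ninv: "\<And>x y. x \<in> K \<Longrightarrow> y \<in> K \<Longrightarrow> snd x * snd y \<noteq> 1"
  shows "inj_on fst K" "pairwise (\<lambda>e f. e * f = 0) (fst ` K)" "card K \<le> N"
proof -
  have orth: "fst x * fst y = 0" if "x \<in> K" "y \<in> K" "x \<noteq> y" for x y
    using K(2) ninv that unfolding pairwise_def clean_adjacent_def by blast
  have sq: "fst x * fst x \<noteq> 0" if "x \<in> K" for x
    using K(1) that by (auto simp: idempotents_def)
  show inj: "inj_on fst K"
    using orth sq by (metis inj_onI)
  show pw: "pairwise (\<lambda>e f. e * f = 0) (fst ` K)"
    using orth by (auto simp: pairwise_def)
  have "card (fst ` K) \<le> N"
    using pw K(1) by (intro orthogonal_card_le) (auto simp: orthogonal_idempotents_def)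
  then show "card K \<le> N" using inj by (simp add: card_image)
qed

text \<open>The vertices with involutive units (\<open>K0\<close>) annihilate the two orthogonal
  families cut out by \<open>H\<close> and its complement (\<open>K1\<close>, \<open>K2\<close>).
  Averaging the bound of \<open>orthogonal_annihilator_card_le\<close> over these two families gives
  the claim.\<close>

lemma nontrivial_clique_card_le:
  fixes K :: "('a \<times> 'a) set"
  assumes K: "K \<subseteq> nontrivial_idempotents \<times> ring_units" "pairwise clean_adjacent K"
  shows "card K \<le> max m (2 * N)"
proof -
  obtain H :: "'a set" where H: "H \<subseteq> noninvolutive_units"
    "\<And>u v. u \<in> H \<Longrightarrow> v \<in> H \<Longrightarrow> u * v \<noteq> 1"
    "\<And>u v. u \<in> noninvolutive_units - H \<Longrightarrow> v \<in> noninvolutive_units - H \<Longrightarrow> u * v \<noteq> 1"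
    using half_of_noninvolutive_units by blast
  define K0 where "K0 = {x \<in> K. snd x * snd x = 1}"
  define K1 where "K1 = {x \<in> K. snd x \<in> H}"
  define K2 where "K2 = {x \<in> K. snd x \<in> noninvolutive_units - H}"
  have sub: "K0 \<subseteq> K" "K1 \<subseteq> K" "K2 \<subseteq> K" by (auto simp: K0_def K1_def K2_def)
  have "K = K0 \<union> K1 \<union> K2"
    using K(1) by (auto simp: K0_def K1_def K2_def noninvolutive_units_iff)
  then have cardK: "card K \<le> card K0 + card K1 + card K2"
    using card_Un_le[of "K0 \<union> K1" K2] card_Un_le[of K0 K1] by simp
  have nontriv: "nontrivial_idempotents \<subseteq> idempotents - {0}" by (auto simp: nontrivial_idempotents_def)
  \<comment> \<open>A unit of \<open>L\<close> is not involutive, hence not inverse to an involutive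
    one, so \<open>K0\<close> and \<open>L\<close> are adjacent by orthogonality alone.\<close>
  have bound: "card K0 + 2 * card L \<le> max m (2 * N)"
    if L: "L \<subseteq> K" "\<And>x y. x \<in> L \<Longrightarrow> y \<in> L \<Longrightarrow> snd x * snd y \<noteq> 1" for L
  proof -
    have LN: "L \<subseteq> (idempotents - {0}) \<times> ring_units" "pairwise clean_adjacent L"
      using L K nontriv pairwise_subset by blast+
    have K0N: "K0 \<subseteq> nontrivial_idempotents \<times> ring_units" "pairwise clean_adjacent K0"
      "\<And>x. x \<in> K0 \<Longrightarrow> snd x * snd x = 1"
      using sub K pairwise_subset by (blast, blast, simp add: K0_def)
    have "card (fst ` K0) + 2 * card (fst ` L) \<le> max m (2 * N)"
    proof (rule orthogonal_annihilator_card_le)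
      show "fst ` K0 \<subseteq> nontrivial_idempotents" "fst ` L \<subseteq> nontrivial_idempotents"
        using K(1) L(1) sub by auto
      show "pairwise (\<lambda>e f. e * f = 0) (fst ` L)"
        by (rule orthogonal_clique_card_le(2)[OF LN L(2)])
      fix a b assume "a \<in> fst ` K0" "b \<in> fst ` L"
      then obtain x y where xy: "x \<in> K0" "y \<in> L" "a = fst x" "b = fst y" by auto
      have "snd x \<noteq> snd y" using K0N(3)[OF xy(1)] L(2)[OF xy(2) xy(2)] by auto
      moreover have "snd x * snd y \<noteq> 1"
        using K0N(3)[OF xy(1)] \<open>snd x \<noteq> snd y\<close> inverse_unique_comm_ring by blast
      ultimately show "a * b = 0"
        using K(2) sub(1) L(1) xy unfolding pairwise_def clean_adjacent_def by fastforce
    qed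
    then show ?thesis
      using orthogonal_clique_card_le(1)[OF LN L(2)] involutive_clique_card_le(1)[OF K0N]
      by (simp add: card_image)
  qed
  have "card K0 + 2 * card K1 \<le> max m (2 * N)" "card K0 + 2 * card K2 \<le> max m (2 * N)"
    using H by (intro bound sub; auto simp: K1_def K2_def)+
  then show ?thesis using cardK by linarith
qed

text \<open>Once \<open>(1, v)\<close> lies in the clique, all other vertices carry the inverse of
  \<open>v\<close>, since 1 annihilates nothing nonzero. For involutive \<open>v\<close> the clique
  sits in one slice of \<open>m + 1\<close> vertices. Otherwise the others form an orthogonal
  family, and \<open>N + 1\<close> is at most \<open>2 * N\<close>.\<close>

lemma clique_card_le:
  fixes K :: "('a \<times> 'a) set"
  assumes K: "K \<subseteq> (idempotents - {0}) \<times> ring_units" "pairwise clean_adjacent K"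
  shows "card K \<le> max (m + 1) (2 * N)"
    and "noninvolutive_units = ({} :: 'a set) \<Longrightarrow> card K \<le> m + 1"
proof -
  have finK: "finite K"
    using K(1) finite_idempotents finite_units by (meson finite_Diff finite_SigmaI finite_subset)
  have adj: "fst x * fst y = 0 \<or> snd x * snd y = 1" if "x \<in> K" "y \<in> K" "x \<noteq> y" for x y
    using K(2) that unfolding pairwise_def clean_adjacent_def by blast
  have one: "card K \<le> m + 1 \<or> (noninvolutive_units \<noteq> ({} :: 'a set) \<and> card K \<le> 2 * N)"
    if v: "(1, v) \<in> K" for v
  proof -
    have others: "v * snd x = 1" if "x \<in> K" "x \<noteq> (1, v)" for x
      using adj[OF v that(1)] that K(1) by auto
    show ?thesis
    proof (cases "v * v = 1")
      case True
      then have "K \<subseteq> (idempotents - {0}) \<times> {v}"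
        using others inverse_unique_comm_ring K(1) by force
      then have "card K \<le> card ((idempotents - {0 :: 'a}) \<times> {v})"
        by (rule card_mono[rotated]) (simp add: finite_idempotents)
      then show ?thesis using card_nonzero_idempotents by (simp add: card_cartesian_product)
    next
      case False
      have "card (K - {(1, v)}) \<le> N"
      proof (rule orthogonal_clique_card_le(3))
        show "K - {(1, v)} \<subseteq> (idempotents - {0}) \<times> ring_units" using K(1) by auto
        show "pairwise clean_adjacent (K - {(1, v)})" using K(2) by (rule pairwise_subset) auto
        fix x y assume "x \<in> K - {(1, v)}" "y \<in> K - {(1, v)}"
        then have xy: "v * snd x = 1" "v * snd y = 1" using others by auto
        then have "snd x = snd y" using inverse_unique_comm_ring by blast
        then show "snd x * snd y \<noteq> 1"
          using xy False inverse_unique_comm_ring[of "snd y" "snd y" v] by (auto simp: mult.commute)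
      qed
      moreover have "card K = card (K - {(1, v)}) + 1" using card_Suc_Diff1[OF finK v] by simp
      moreover have "v \<in> noninvolutive_units" using v K(1) False by (auto simp: noninvolutive_units_iff)
      ultimately show ?thesis using two_le_N by auto
    qed
  qed
  have nontriv: "K \<subseteq> nontrivial_idempotents \<times> ring_units" if "\<nexists>v. (1, v) \<in> K"
    using K(1) that by (auto simp: nontrivial_idempotents_def)
  show "card K \<le> max (m + 1) (2 * N)"
    using one nontrivial_clique_card_le[OF nontriv K(2)] by fastforce
  assume "noninvolutive_units = ({} :: 'a set)"
  moreover from this have "snd x * snd x = 1" if "x \<in> K" for x
    using K(1) that noninvolutive_units_iff[of "snd x"] by auto
  ultimately show "card K \<le> m + 1"
    using one involutive_clique_card_le(2)[OF nontriv K(2)] by fastforce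
qed

text \<open>The vertices with nontrivial idempotents form a clique, and those with idempotent 1 are
  at most one pair of inverse units. With exactly two noninvolutive units the two parts compete: a
  full pair in \<open>I1\<close> leaves only involutive units to \<open>I0\<close>.\<close>

lemma compatible_card_le:
  fixes I :: "('a \<times> 'a) set"
  assumes I: "I \<subseteq> (idempotents - {0}) \<times> ring_units" "pairwise clean2_compatible I"
  shows "card I \<le> max m (2 * N) + 2"
    and "noninvolutive_units = ({} :: 'a set) \<Longrightarrow> card I \<le> m + 1"
    and "card (noninvolutive_units :: 'a set) = 2 \<Longrightarrow> card I \<le> max (m + 2) (2 * N + 1)"
proof -
  define I0 where "I0 = {x \<in> I. fst x \<noteq> 1}"
  define I1 where "I1 = {x \<in> I. fst x = 1}"
  have finI: "finite I"
    using I(1) finite_idempotents finite_units by (meson finite_Diff finite_SigmaI finite_subset)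
  have "I = I0 \<union> I1" "I0 \<inter> I1 = {}" by (auto simp: I0_def I1_def)
  then have cardI: "card I = card I0 + card I1" using finI by (metis card_Un_disjoint finite_Un)
  have I0: "I0 \<subseteq> nontrivial_idempotents \<times> ring_units" "pairwise clean_adjacent I0"
    using I by (auto simp: I0_def nontrivial_idempotents_def pairwise_def clean2_compatible_def)
  note card_I0 = nontrivial_clique_card_le[OF I0]
  have I1: "x = y \<or> snd x * snd y = 1" if "x \<in> I1" "y \<in> I1" for x y
    using pairwiseD[OF I(2), of x y] that by (auto simp: I1_def clean2_compatible_def)
  \<comment> \<open>Of three pairwise inverse units two would be inverses of the third, hence
    equal.\<close>
  have card_I1: "card I1 \<le> 1 \<or> (\<exists>u v. I1 = {(1, u), (1, v)} \<and> u * v = 1 \<and> u \<noteq> v)"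
  proof (cases "card I1 \<le> 1")
    case False
    then obtain x y where xy: "x \<in> I1" "y \<in> I1" "x \<noteq> y"
      by (metis card_le_Suc0_iff_eq One_nat_def finI I1_def finite_Collect_conjI finite_subset
          Collect_mem_eq)
    then have *: "fst x = 1" "fst y = 1" "snd x * snd y = 1"
      using I1[OF xy(1,2)] by (auto simp: I1_def)
    have "z = x \<or> z = y" if "z \<in> I1" for z
      using I1[OF xy(1) that] * that inverse_unique_comm_ring[of "snd x" "snd y" "snd z"]
      by (auto simp: I1_def prod_eq_iff)
    then have "I1 = {x, y}" using xy by blast
    then have "I1 = {(1, snd x), (1, snd y)}" using * by (metis prod.collapse)
    moreover have "snd x \<noteq> snd y" using * xy(3) by (metis prod.expand)
    ultimately show ?thesis using *(3) by blast
  qed simp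
  then have "card I1 \<le> 2" by (auto simp: card_insert_if)
  then show "card I \<le> max m (2 * N) + 2" using cardI card_I0 by linarith
  have pair: "u \<in> noninvolutive_units \<and> v \<in> noninvolutive_units \<and> card I1 = 2"
    if "I1 = {(1, u), (1, v)}" "u * v = 1" "u \<noteq> v" for u v
  proof -
    have "(1, u) \<in> I" "(1, v) \<in> I" using that(1) by (auto simp: I1_def)
    then have "u \<in> ring_units" "v \<in> ring_units" using I(1) by auto
    moreover have "u * u \<noteq> 1" "v * v \<noteq> 1"
      using that(2,3) inverse_unique_comm_ring[of u u v] inverse_unique_comm_ring[of v v u]
      by (auto simp: mult.commute)
    ultimately show ?thesis using that by (simp add: noninvolutive_units_iff)
  qed
  show "card I \<le> m + 1" if none: "noninvolutive_units = ({} :: 'a set)"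
  proof -
    have "card I1 \<le> 1" using card_I1 pair none by blast
    moreover have "snd x * snd x = 1" if "x \<in> I0" for x
      using I0(1) that none noninvolutive_units_iff[of "snd x"] by auto
    then have "card I0 \<le> m" using involutive_clique_card_le(2)[OF I0] by blast
    ultimately show ?thesis using cardI by linarith
  qed
  show "card I \<le> max (m + 2) (2 * N + 1)" if two: "card (noninvolutive_units :: 'a set) = 2"
    using card_I1
  proof
    assume "card I1 \<le> 1"
    then show ?thesis using cardI card_I0 by linarith
  next
    assume "\<exists>u v. I1 = {(1, u), (1, v)} \<and> u * v = 1 \<and> u \<noteq> v"
    then obtain u v where uv: "I1 = {(1, u), (1, v)}" "u * v = 1" "u \<noteq> v" by blast
    have fin: "finite (noninvolutive_units :: 'a set)" using two by (metis card.infinite zero_neq_numeral)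
    \<comment> \<open>The pair in \<open>I1\<close> exhausts the noninvolutive units, and
      compatibility with it keeps both out of \<open>I0\<close>.\<close>
    have "{u, v} = noninvolutive_units"
      using pair[OF uv] two uv(3) by (intro card_subset_eq[OF fin]) auto
    moreover have "snd x \<noteq> w" if "x \<in> I0" "w \<in> {u, v}" "w * w \<noteq> 1" for x w
    proof -
      have "(1, w) \<in> I" using uv(1) that(2) by (auto simp: I1_def)
      then have "clean2_compatible x (1, w)"
        using pairwiseD[OF I(2), of x "(1, w)"] that(1) by (cases x) (auto simp: I0_def)
      then show ?thesis using that(1,3) by (auto simp: clean2_compatible_def I0_def)
    qed
    ultimately have "snd x \<notin> noninvolutive_units" if "x \<in> I0" for x
      using that noninvolutive_units_iff by metis
    then have "snd x * snd x = 1" if "x \<in> I0" for x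
      using I0(1) that noninvolutive_units_iff[of "snd x"] by auto
    then have "card I0 \<le> m" using involutive_clique_card_le(2)[OF I0] by blast
    then show ?thesis using cardI \<open>card I1 \<le> 2\<close> by linarith
  qed
qed

end

subsection \<open>Distances in the clean graphs\<close>

lemma verts_clean_graph: "verts clean_graph = idempotents \<times> ring_units"
  by (simp add: clean_graph_def)

lemma verts_clean_graph_2: "verts clean_graph_2 = (idempotents - {0}) \<times> ring_units"
  by (auto simp: clean_graph_2_def clean_graph_def)

lemma arcs_clean_graph:
  "arcs clean_graph = {(x, y). x \<in> verts clean_graph \<and> y \<in> verts clean_graph \<and> x \<noteq> y \<and> clean_adjacent x y}"
  by (auto simp: clean_graph_def clean_adjacent_def)

lemma arcs_clean_graph_2:
  "arcs clean_graph_2 =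
    {(x, y). x \<in> verts clean_graph_2 \<and> y \<in> verts clean_graph_2 \<and> x \<noteq> y \<and> clean_adjacent x y}"
  by (auto simp: clean_graph_2_def clean_graph_def clean_adjacent_def)

lemma clean_graph_ends [simp]:
  "tail clean_graph = fst" "head clean_graph = snd"
  "tail clean_graph_2 = fst" "head clean_graph_2 = snd"
  by (simp_all add: clean_graph_def clean_graph_2_def)

lemma clean_graph_adj_iff:
  "x \<rightarrow>\<^bsub>clean_graph\<^esub> y \<longleftrightarrow>
     x \<in> verts clean_graph \<and> y \<in> verts clean_graph \<and> x \<noteq> y \<and> clean_adjacent x y"
  by (simp add: arcs_ends_conv arcs_clean_graph)

lemma clean_graph_2_adj_iff:
  "x \<rightarrow>\<^bsub>clean_graph_2\<^esub> y \<longleftrightarrow>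
     x \<in> verts clean_graph_2 \<and> y \<in> verts clean_graph_2 \<and> x \<noteq> y \<and> clean_adjacent x y"
  by (simp add: arcs_ends_conv arcs_clean_graph_2)

lemma graph_clean_graph_2:
  assumes "finite (verts (clean_graph :: ('a::comm_ring_1 \<times> 'a, _) pre_digraph))"
  shows "graph (clean_graph_2 :: ('a \<times> 'a, _) pre_digraph)"
proof -
  let ?G = "clean_graph_2 :: ('a \<times> 'a, _) pre_digraph"
  have "verts ?G \<subseteq> verts clean_graph" by (auto simp: verts_clean_graph verts_clean_graph_2)
  then have fin: "finite (verts ?G)" using assms by (rule finite_subset)
  have sub: "arcs ?G \<subseteq> verts ?G \<times> verts ?G" by (auto simp: arcs_clean_graph_2)
  then have "finite (arcs ?G)" using fin by (meson finite_SigmaI finite_subset)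
  moreover have "symmetric ?G"
    unfolding symmetric_def sym_def clean_graph_2_adj_iff using clean_adjacent_sym by metis
  ultimately show ?thesis
    using fin by unfold_locales (simp_all add: arcs_clean_graph_2 arc_to_ends_def split: prod.splits)
qed

context clean_ring
begin

lemma finite_verts_clean_graph: "finite (verts (clean_graph :: ('a \<times> 'a, _) pre_digraph))"
  using finite_idempotents finite_units by (simp add: verts_clean_graph)

lemma card_verts_clean_graph:
  "card (verts (clean_graph :: ('a \<times> 'a, _) pre_digraph)) = (m + 2) * card (ring_units :: 'a set)"
  using card_idempotents[OF finite_idempotents] card_nontrivial
  by (simp add: verts_clean_graph card_cartesian_product)

lemma card_verts_clean_graph_2:
  "card (verts (clean_graph_2 :: ('a \<times> 'a, _) pre_digraph)) = (m + 1) * card (ring_units :: 'a set)"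
  using card_nonzero_idempotents by (simp add: verts_clean_graph_2 card_cartesian_product)

text \<open>A vertex carrying such a \<open>w\<close> can be adjacent to a vertex carrying
  \<open>v\<close> only through orthogonal idempotents. If \<open>v\<close> is involutive any other
  unit will do; otherwise 1 does.\<close>

lemma ex_unit_apart:
  assumes "2 \<le> card (ring_units :: 'a set)" "v \<in> ring_units"
  obtains w :: 'a where "w \<in> ring_units" "w \<noteq> v" "w * v \<noteq> 1"
proof (cases "v * v = 1")
  case True
  have "\<not> (ring_units :: 'a set) \<subseteq> {v}" using assms(1) card_mono[of "{v}" ring_units] by auto
  then obtain w where "w \<in> ring_units" "w \<noteq> v" by auto
  moreover have "w * v \<noteq> 1"
    using True \<open>w \<noteq> v\<close> inverse_unique_comm_ring[of v v w] by (auto simp: mult.commute)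
  ultimately show ?thesis using that by blast
next
  case False
  then have "v \<noteq> 1" by auto
  then show ?thesis using that[of 1] by simp
qed

text \<open>Adjacent vertices fail to be mutually maximally distant as soon as some neighbour of one
  is not adjacent to the other; \<open>z\<close> is this witness.\<close>

lemma clean_graph_2_twin_free:
  assumes "2 \<le> card (ring_units :: 'a set)"
    and "x \<in> verts clean_graph_2" "y \<in> verts (clean_graph_2 :: ('a \<times> 'a, _) pre_digraph)"
    and "x \<noteq> y" "clean_adjacent x y"
  obtains z where "z \<in> verts clean_graph_2" "z \<noteq> x" "z \<noteq> y"
    "clean_adjacent z x \<and> \<not> clean_adjacent z y \<or> clean_adjacent z y \<and> \<not> clean_adjacent z x"
proof -
  have separated: "\<exists>z \<in> verts clean_graph_2. z \<noteq> x \<and> z \<noteq> y \<and> clean_adjacent z x \<and> \<not> clean_adjacent z y"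
    if xy: "x \<in> verts clean_graph_2" "y \<in> verts clean_graph_2" and g: "(1 - fst x) * fst y \<noteq> 0"
    for x y :: "'a \<times> 'a"
  proof -
    obtain e u f v where eq: "x = (e, u)" "y = (f, v)" by fastforce
    have ef: "e * e = e" "f * f = f" "e \<noteq> 0" "v \<in> ring_units"
      using xy eq by (auto simp: verts_clean_graph_2 idempotents_def)
    obtain w where w: "w \<in> ring_units" "w \<noteq> v" "w * v \<noteq> 1"
      using ex_unit_apart[OF assms(1) ef(4)] by blast
    \<comment> \<open>\<open>h\<close> is the part of \<open>f\<close> orthogonal to
      \<open>e\<close>: it gives adjacency to \<open>x\<close>, while \<open>h * f\<close> is
      nonzero and \<open>w\<close> excludes adjacency to \<open>y\<close> through units.\<close>
    define h where "h = (1 - e) * f"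
    have "(1 - e) * (1 - e) = 1 - e" using ef(1) by (simp add: algebra_simps)
    then have h: "h * h = h" unfolding h_def using ef(2)
      by (metis mult.assoc mult.commute)
    have "e * (1 - e) = 0" using ef(1) by (simp add: algebra_simps)
    then have he: "h * e = 0" "h * f = h"
      unfolding h_def using ef(2) by (metis mult.assoc mult.commute mult_zero_left, metis mult.assoc)
    have "h \<noteq> 0" using g eq by (simp add: h_def)
    then have "h \<noteq> e" using he(1) h by metis
    then show ?thesis
      using w h he \<open>h \<noteq> 0\<close> eq
      by (intro bexI[of _ "(h, w)"]) (auto simp: clean_adjacent_def verts_clean_graph_2 idempotents_def)
  qed
  consider "(1 - fst x) * fst y \<noteq> 0" | "(1 - fst y) * fst x \<noteq> 0"
    | "(1 - fst x) * fst y = 0" "(1 - fst y) * fst x = 0" by blast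
  then show ?thesis
  proof cases
    case 1
    then show ?thesis using separated[OF assms(2,3)] that by blast
  next
    case 2
    then show ?thesis using separated[OF assms(3,2)] that by blast
  next
    case 3
    then have "fst x = fst y" by (simp add: algebra_simps)
    then obtain e u v where eq: "x = (e, u)" "y = (e, v)" by (metis prod.collapse)
    have e: "e * e = e" "e \<noteq> 0" "u \<in> ring_units" "v \<in> ring_units" "u \<noteq> v"
      using assms(2-4) eq by (auto simp: verts_clean_graph_2 idempotents_def)
    then have uv: "u * v = 1" using assms(5) eq by (simp add: clean_adjacent_def)
    have vv: "v * v \<noteq> 1"
      using uv e(5) inverse_unique_comm_ring[of v v u] by (auto simp: mult.commute)
    obtain h :: 'a where h: "h \<in> nontrivial_idempotents" using ex_nontrivial by auto
    show ?thesis
    \<comment> \<open>The units are inverse and distinct. A vertex with unit \<open>v\<close> and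
      another idempotent not orthogonal to \<open>e\<close> is adjacent to \<open>x\<close> but not
      to \<open>y\<close>; that idempotent is \<open>h\<close> if \<open>e\<close> is 1, and 1
      otherwise.\<close>
    proof (cases "e = 1")
      case True
      then show ?thesis using that[of "(h, v)"] h eq e uv vv
        by (auto simp: verts_clean_graph_2 nontrivial_idempotents_def clean_adjacent_def mult.commute)
    next
      case False
      then show ?thesis using that[of "(1, v)"] eq e uv vv
        by (auto simp: verts_clean_graph_2 idempotents_def clean_adjacent_def mult.commute)
    qed
  qed
qed

section \<open>Strong metric dimension from maximum cliques and compatible sets\<close>

text \<open>A maximum independent set consists of a maximum clique with nonzero idempotents and a
  single vertex with idempotent 0: two of the latter are universal and therefore mutually maximally
  distant.\<close>

lemma sdim_clean_graph:
  fixes K :: "('a \<times> 'a) set"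
  assumes two: "2 \<le> card (ring_units :: 'a set)"
    and K: "K \<subseteq> (idempotents - {0}) \<times> ring_units" "pairwise clean_adjacent K"
    and max: "\<And>L :: ('a \<times> 'a) set. L \<subseteq> (idempotents - {0}) \<times> ring_units \<Longrightarrow>
      pairwise clean_adjacent L \<Longrightarrow> card L \<le> card K"
  shows "sdim (clean_graph :: ('a \<times> 'a, _) pre_digraph) + card K + 1
    = (m + 2) * card (ring_units :: 'a set)"
proof -
  let ?G = "clean_graph :: ('a \<times> 'a, _) pre_digraph"
  interpret graph ?G using graph_clean_graph[OF finite_verts_clean_graph] .
  define d :: "'a \<times> 'a \<Rightarrow> 'a \<times> 'a \<Rightarrow> nat"
    where "d = (\<lambda>x y. if x = y then 0 else if x \<rightarrow>\<^bsub>?G\<^esub> y then 1 else 2)"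
  have zero_adj: "clean_adjacent x y" if "fst x = 0 \<or> fst y = 0" for x y :: "'a \<times> 'a"
    using that by (auto simp: clean_adjacent_def)
  interpret graph_distance ?G d
    unfolding d_def
  proof (rule graph_distance_diameter_2)
    fix x y assume xy: "x \<in> verts ?G" "y \<in> verts ?G" "x \<noteq> y" "\<not> x \<rightarrow>\<^bsub>?G\<^esub> y"
    then have "\<not> clean_adjacent x y" by (simp add: clean_graph_adj_iff)
    then have "fst x \<noteq> 0" "fst y \<noteq> 0" using zero_adj by blast+
    then show "\<exists>z. x \<rightarrow>\<^bsub>?G\<^esub> z \<and> z \<rightarrow>\<^bsub>?G\<^esub> y"
      using xy by (intro exI[of _ "(0, 1)"])
        (auto simp: clean_graph_adj_iff zero_adj verts_clean_graph idempotents_def)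
  qed
  have d_val: "d x y = (if x = y then 0 else if clean_adjacent x y then 1 else 2)"
    if "x \<in> verts ?G" "y \<in> verts ?G" for x y
    using that by (simp add: d_def clean_graph_adj_iff)
  have V2: "verts clean_graph_2 \<subseteq> verts ?G" by (auto simp: verts_clean_graph verts_clean_graph_2)
  \<comment> \<open>The vertex \<open>(1, w)\<close> is adjacent to the universal vertex
    \<open>x\<close> but at distance 2 from \<open>y\<close>, whereas \<open>x\<close> and
    \<open>y\<close> are at distance 1.\<close>
  have zero_nonzero: "\<not> mutually_maximally_distant x y"
    if xy: "x \<in> verts ?G" "y \<in> verts ?G" "fst x = 0" "fst y \<noteq> 0" for x y
  proof -
    have "snd y \<in> ring_units" using xy by (auto simp: verts_clean_graph)
    then obtain w where w: "w \<in> ring_units" "w \<noteq> snd y" "w * snd y \<noteq> 1"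
      using ex_unit_apart[OF two] by blast
    have z: "(1, w) \<rightarrow>\<^bsub>?G\<^esub> x"
      using xy w by (auto simp: clean_graph_adj_iff zero_adj verts_clean_graph idempotents_def)
    have "d (1, w) y = 2"
      using w xy by (subst d_val) (auto simp: clean_adjacent_def verts_clean_graph idempotents_def)
    moreover have "d x y = 1" using xy by (auto simp: d_val zero_adj)
    ultimately show ?thesis using z unfolding mutually_maximally_distant_def by fastforce
  qed
  have not_mmd: "\<not> mutually_maximally_distant x y \<longleftrightarrow> clean_adjacent x y \<and> \<not> (fst x = 0 \<and> fst y = 0)"
    if xy: "x \<in> verts ?G" "y \<in> verts ?G" "x \<noteq> y" for x y
  proof (cases "clean_adjacent x y \<and> \<not> (fst x = 0 \<and> fst y = 0)")
    case False
    have "mutually_maximally_distant x y"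
    proof (cases "clean_adjacent x y")
      case True
      then have "fst x = 0" "fst y = 0" using False by auto
      then show ?thesis using xy by (intro mmdI) (simp_all add: d_val zero_adj)
    next
      case False
      then show ?thesis using xy by (intro mmdI) (simp_all add: d_val)
    qed
    then show ?thesis using False by simp
  next
    case True
    consider "fst x = 0" "fst y \<noteq> 0" | "fst x \<noteq> 0" "fst y = 0" | "fst x \<noteq> 0" "fst y \<noteq> 0"
      using True by blast
    then have "\<not> mutually_maximally_distant x y"
    proof cases
      case 1
      then show ?thesis using zero_nonzero xy by blast
    next
      case 2
      then show ?thesis using zero_nonzero xy mmd_sym by blast
    next
      case 3
      then have "x \<in> verts clean_graph_2" "y \<in> verts clean_graph_2"
        using xy by (auto simp: verts_clean_graph verts_clean_graph_2)
      then obtain z where z: "z \<in> verts clean_graph_2" "z \<noteq> x" "z \<noteq> y"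
        "clean_adjacent z x \<and> \<not> clean_adjacent z y \<or> clean_adjacent z y \<and> \<not> clean_adjacent z x"
        using clean_graph_2_twin_free[OF two] xy(3) True by metis
      have zG: "z \<in> verts ?G" using z(1) V2 by blast
      have dxy: "d x y = 1" using xy True by (simp add: d_val)
      from z(4) show ?thesis
      proof
        assume zx: "clean_adjacent z x \<and> \<not> clean_adjacent z y"
        then have "z \<rightarrow>\<^bsub>?G\<^esub> x" "d z y = 2" using xy zG z by (auto simp: clean_graph_adj_iff d_val)
        then show ?thesis using dxy unfolding mutually_maximally_distant_def by fastforce
      next
        assume zy: "clean_adjacent z y \<and> \<not> clean_adjacent z x"
        then have "z \<rightarrow>\<^bsub>?G\<^esub> y" "d x z = 2"
          using xy zG z clean_adjacent_sym[of z x] by (auto simp: clean_graph_adj_iff d_val)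
        then show ?thesis using dxy unfolding mutually_maximally_distant_def by fastforce
      qed
    qed
    then show ?thesis using True by blast
  qed
  have indep: "mmd_independent I \<longleftrightarrow> I \<subseteq> verts ?G \<and>
      pairwise (\<lambda>x y. clean_adjacent x y \<and> \<not> (fst x = 0 \<and> fst y = 0)) I" for I
    by (rule mmd_independent_iff) (rule not_mmd)
  have finK: "finite K"
    using K(1) finite_idempotents finite_units by (meson finite_Diff finite_SigmaI finite_subset)
  have new: "(0, 1) \<notin> K" using K(1) by auto
  have "sdim ?G + card (insert (0, 1) K) = card (verts ?G)"
  proof (rule sdim_plus_card_independent)
    show "mmd_independent (insert (0, 1) K)"
      unfolding indep using K
      by (auto simp: pairwise_def verts_clean_graph idempotents_def zero_adj)
    fix J assume "mmd_independent J"
    then have J: "J \<subseteq> verts ?G"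
      "\<And>x y. x \<in> J \<Longrightarrow> y \<in> J \<Longrightarrow> x \<noteq> y \<Longrightarrow> clean_adjacent x y \<and> \<not> (fst x = 0 \<and> fst y = 0)"
      unfolding indep pairwise_def by blast+
    have finJ: "finite J" using J(1) finite_verts finite_subset by blast
    have "x = y" if "x \<in> {x \<in> J. fst x = 0}" "y \<in> {x \<in> J. fst x = 0}" for x y
      using that J(2)[of x y] by blast
    then have "card {x \<in> J. fst x = 0} \<le> 1"
      using finJ card_le_Suc0_iff_eq[of "{x \<in> J. fst x = 0}"] by simp
    moreover have "card {x \<in> J. fst x \<noteq> 0} \<le> card K"
      using J by (intro max) (auto simp: verts_clean_graph pairwise_def)
    moreover have "{x \<in> J. fst x = 0} \<union> {x \<in> J. fst x \<noteq> 0} = J" by blast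
    then have "card J \<le> card {x \<in> J. fst x = 0} + card {x \<in> J. fst x \<noteq> 0}"
      using card_Un_le[of "{x \<in> J. fst x = 0}" "{x \<in> J. fst x \<noteq> 0}"] by simp
    ultimately show "card J \<le> card (insert (0, 1) K)" using finK new by simp
  qed
  then show ?thesis using finK new card_verts_clean_graph by simp
qed

lemma sdim_clean_graph_2:
  fixes I :: "('a \<times> 'a) set"
  assumes two: "2 \<le> card (ring_units :: 'a set)"
    and I: "I \<subseteq> (idempotents - {0}) \<times> ring_units" "pairwise clean2_compatible I"
    and max: "\<And>J :: ('a \<times> 'a) set. J \<subseteq> (idempotents - {0}) \<times> ring_units \<Longrightarrow>
      pairwise clean2_compatible J \<Longrightarrow> card J \<le> card I"
  shows "sdim (clean_graph_2 :: ('a \<times> 'a, _) pre_digraph) + card I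
    = (m + 1) * card (ring_units :: 'a set)"
proof -
  let ?G = "clean_graph_2 :: ('a \<times> 'a, _) pre_digraph"
  interpret graph ?G using graph_clean_graph_2[OF finite_verts_clean_graph] .
  \<comment> \<open>Neighbours of a vertex with idempotent 1 all carry the inverse unit, so two
    distinct nonadjacent vertices of this kind have no common neighbour; this is the source of the
    value 3.\<close>
  define d :: "'a \<times> 'a \<Rightarrow> 'a \<times> 'a \<Rightarrow> nat"
    where "d x y = (if x = y then 0 else if clean_adjacent x y then 1
      else if fst x = 1 \<and> fst y = 1 then 3 else 2)" for x y
  have nonzero: "fst x \<noteq> 0" "fst x * fst x = fst x" "snd x \<in> ring_units" if "x \<in> verts ?G" for x
    using that by (auto simp: verts_clean_graph_2 idempotents_def)
  have inv_unique: "v = w" if "u * v = 1" "w * u = 1" for u v w :: 'a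
    using that inverse_unique_comm_ring[of u v w] by (simp add: mult.commute)
  obtain h :: 'a where h: "h * h = h" "h \<noteq> 0" "h \<noteq> 1"
    using ex_nontrivial by (auto simp: nontrivial_idempotents_def idempotents_def)
  \<comment> \<open>The common neighbour is \<open>(1 - fst x, v)\<close>: orthogonal to
    \<open>x\<close>, and with unit inverse to that of \<open>y\<close>. It is a vertex because
    \<open>fst x\<close> is not 1.\<close>
  have common: "\<exists>z. z \<rightarrow>\<^bsub>?G\<^esub> x \<and> z \<rightarrow>\<^bsub>?G\<^esub> y"
    if xy: "x \<in> verts ?G" "y \<in> verts ?G" "\<not> clean_adjacent x y" "fst x \<noteq> 1" for x y
  proof -
    obtain v where v: "v \<in> ring_units" "snd y * v = 1"
      using ring_unit_has_inverse nonzero(3)[OF xy(2)] by blast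
    have "fst x * fst y \<noteq> 0" using xy(3) by (simp add: clean_adjacent_def)
    have *: "fst x * (1 - fst x) = 0" using nonzero(2)[OF xy(1)] by (simp add: algebra_simps)
    have "(1 - fst x) * (1 - fst x) = 1 - fst x" using nonzero(2)[OF xy(1)] by (simp add: algebra_simps)
    then have "(1 - fst x, v) \<in> verts ?G" using v(1) xy(4) by (simp add: verts_clean_graph_2 idempotents_def)
    moreover have "(1 - fst x, v) \<noteq> x" using * nonzero[OF xy(1)] by (metis fst_conv)
    moreover have "(1 - fst x, v) \<noteq> y" using * \<open>fst x * fst y \<noteq> 0\<close> by (metis fst_conv)
    ultimately show ?thesis using xy v *
      by (intro exI[of _ "(1 - fst x, v)"]) (simp add: clean_graph_2_adj_iff clean_adjacent_def mult.commute)
  qed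
  interpret graph_distance ?G d
  proof unfold_locales
    fix x y z assume x: "x \<in> verts ?G" and yz: "y \<rightarrow>\<^bsub>?G\<^esub> z"
    then have yz': "y \<in> verts ?G" "z \<in> verts ?G" "y \<noteq> z" "clean_adjacent y z"
      by (auto simp: clean_graph_2_adj_iff)
    \<comment> \<open>Were it 3, both \<open>x\<close> and \<open>z\<close> would have idempotent 1
      and the unit inverse to that of \<open>y\<close>, hence coincide.\<close>
    have "d x z \<noteq> 3" if y: "clean_adjacent x y"
    proof
      assume "d x z = 3"
      then have *: "fst x = 1" "fst z = 1" "x \<noteq> z" by (auto simp: d_def split: if_splits)
      then have "snd x * snd y = 1" "snd y * snd z = 1"
        using y yz' nonzero(1)[OF yz'(1)] by (auto simp: clean_adjacent_def)
      then have "snd x = snd z" using inv_unique[of "snd y" "snd z" "snd x"] by simp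
      then show False using * by (simp add: prod_eq_iff)
    qed
    then show "d x z \<le> d x y + 1" using yz'(4) by (auto simp: d_def split: if_splits)
  next
    fix x y assume xy: "x \<in> verts ?G" "y \<in> verts ?G" "x \<noteq> y"
    consider "clean_adjacent x y" | "\<not> clean_adjacent x y" "fst x \<noteq> 1 \<or> fst y \<noteq> 1"
      | "\<not> clean_adjacent x y" "fst x = 1" "fst y = 1" by blast
    then show "\<exists>z. z \<rightarrow>\<^bsub>?G\<^esub> y \<and> d x z + 1 = d x y"
    proof cases
      case 1
      then show ?thesis using xy by (intro exI[of _ x]) (simp add: clean_graph_2_adj_iff d_def)
    next
      case 2
      then obtain z where "z \<rightarrow>\<^bsub>?G\<^esub> x" "z \<rightarrow>\<^bsub>?G\<^esub> y"
        using common[of x y] common[of y x] xy clean_adjacent_sym by blast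
      then show ?thesis using 2 xy clean_adjacent_sym[of x z]
        by (intro exI[of _ z]) (auto simp: clean_graph_2_adj_iff d_def)
    next
      \<comment> \<open>A nontrivial idempotent with the inverse of the unit of \<open>y\<close>
        gives a neighbour of \<open>y\<close> at distance 2 from \<open>x\<close>.\<close>
      case 3
      obtain v where v: "v \<in> ring_units" "snd y * v = 1"
        using ring_unit_has_inverse nonzero(3)[OF xy(2)] by blast
      have "snd x \<noteq> snd y" using xy(3) 3 by (simp add: prod_eq_iff)
      then have "snd x * v \<noteq> 1" using inv_unique[of v "snd y" "snd x"] v by (auto simp: mult.commute)
      then have "\<not> clean_adjacent x (h, v)" using 3 h by (simp add: clean_adjacent_def)
      moreover have "(h, v) \<rightarrow>\<^bsub>?G\<^esub> y"
        using xy h v 3 by (auto simp: clean_graph_2_adj_iff clean_adjacent_def verts_clean_graph_2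
            idempotents_def mult.commute)
      moreover have "x \<noteq> (h, v)" using 3 h by auto
      ultimately show ?thesis using 3 h xy by (intro exI[of _ "(h, v)"]) (simp add: d_def)
    qed
  qed (simp add: d_def)
  have adjacent: "\<not> mutually_maximally_distant x y"
    if xy: "x \<in> verts ?G" "y \<in> verts ?G" "x \<noteq> y" "clean_adjacent x y" for x y
  proof -
    obtain z where z: "z \<in> verts ?G" "z \<noteq> x" "z \<noteq> y"
      "clean_adjacent z x \<and> \<not> clean_adjacent z y \<or> clean_adjacent z y \<and> \<not> clean_adjacent z x"
      using clean_graph_2_twin_free[OF two xy] by metis
    have dxy: "d x y = 1" using xy by (simp add: d_def)
    from z(4) show ?thesis
    proof
      assume zx: "clean_adjacent z x \<and> \<not> clean_adjacent z y"
      then have "z \<rightarrow>\<^bsub>?G\<^esub> x" "d z y \<ge> 2" using xy z by (auto simp: clean_graph_2_adj_iff d_def)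
      then show ?thesis using dxy unfolding mutually_maximally_distant_def by fastforce
    next
      assume zy: "clean_adjacent z y \<and> \<not> clean_adjacent z x"
      then have "z \<rightarrow>\<^bsub>?G\<^esub> y" "d x z \<ge> 2"
        using xy z clean_adjacent_sym[of z x] by (auto simp: clean_graph_2_adj_iff d_def)
      then show ?thesis using dxy unfolding mutually_maximally_distant_def by fastforce
    qed
  qed
  \<comment> \<open>For nonadjacent \<open>x\<close> and \<open>y\<close> the distance is 2, and
    only a neighbour \<open>(1, w)\<close> of \<open>x\<close> can be at distance 3 from
    \<open>y\<close>. Then \<open>w\<close> is the inverse of \<open>snd x\<close>, and the distance
    is indeed 3 unless \<open>w\<close> is also inverse to \<open>snd y\<close>, that is, unless the
    units of \<open>x\<close> and \<open>y\<close> agree.\<close>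
  have one_side: "\<not> mutually_maximally_distant x y \<longleftrightarrow> snd x \<noteq> snd y \<or> snd x * snd x = 1"
    if xy: "x \<in> verts ?G" "y \<in> verts ?G" "fst x \<noteq> 1" "fst y = 1" for x y
  proof (cases "clean_adjacent x y")
    case True
    moreover from this have "snd x * snd y = 1"
      using xy nonzero(1)[OF xy(1)] by (simp add: clean_adjacent_def)
    moreover have "x \<noteq> y" using xy by auto
    ultimately show ?thesis using adjacent xy(1,2) by metis
  next
    case False
    then have nadj: "snd x * snd y \<noteq> 1" by (simp add: clean_adjacent_def)
    have dxy: "d x y = 2" using xy False by (auto simp: d_def)
    show ?thesis
    proof (cases "snd x = snd y")
      case True
      have "d z y \<le> 2" if z: "z \<rightarrow>\<^bsub>?G\<^esub> x" for z
      proof -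
        have "snd z * snd x = 1" if "fst z = 1"
          using z that nonzero(1)[OF xy(1)] by (simp add: clean_graph_2_adj_iff clean_adjacent_def)
        then show ?thesis using True by (auto simp: d_def clean_adjacent_def)
      qed
      moreover have "d x z \<le> 2" for z using xy by (simp add: d_def)
      ultimately have "mutually_maximally_distant x y"
        using dxy unfolding mutually_maximally_distant_def by simp
      then show ?thesis using True nadj by simp
    next
      case False
      obtain w where w: "w \<in> ring_units" "snd x * w = 1"
        using ring_unit_has_inverse nonzero(3)[OF xy(1)] by blast
      have "w \<noteq> snd y" using w nadj by auto
      moreover have "w * snd y \<noteq> 1"
        using inv_unique[of w "snd y" "snd x"] w False by auto
      ultimately have "d (1, w) y = 3" using xy by (auto simp: d_def clean_adjacent_def)
      moreover have "(1, w) \<rightarrow>\<^bsub>?G\<^esub> x"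
        using w xy by (auto simp: clean_graph_2_adj_iff clean_adjacent_def verts_clean_graph_2
            idempotents_def mult.commute)
      ultimately have "\<not> mutually_maximally_distant x y"
        using dxy unfolding mutually_maximally_distant_def by fastforce
      then show ?thesis using False by simp
    qed
  qed
  have not_mmd: "\<not> mutually_maximally_distant x y \<longleftrightarrow> clean2_compatible x y"
    if xy: "x \<in> verts ?G" "y \<in> verts ?G" "x \<noteq> y" for x y
  proof -
    consider "fst x = 1" "fst y = 1" | "fst x \<noteq> 1" "fst y \<noteq> 1" | "fst x \<noteq> 1" "fst y = 1"
      | "fst x = 1" "fst y \<noteq> 1" by blast
    then show ?thesis
    proof cases
      case 1
      show ?thesis
      proof (cases "clean_adjacent x y")
        case True
        then show ?thesis using 1 adjacent[OF xy] by (simp add: clean2_compatible_def clean_adjacent_def)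
      next
        case False
        then have "d x y = 3" using 1 xy by (simp add: d_def)
        then have "mutually_maximally_distant x y"
          unfolding mutually_maximally_distant_def by (simp add: d_def)
        then show ?thesis using 1 False by (simp add: clean2_compatible_def clean_adjacent_def)
      qed
    next
      case 2
      show ?thesis
      proof (cases "clean_adjacent x y")
        case True
        then show ?thesis using 2 adjacent[OF xy] by (simp add: clean2_compatible_def)
      next
        case False
        then have "d x y = 2" using 2 xy by (simp add: d_def)
        then have "mutually_maximally_distant x y"
          unfolding mutually_maximally_distant_def using 2 by (simp add: d_def)
        then show ?thesis using 2 False by (simp add: clean2_compatible_def)
      qed
    next
      case 3
      then show ?thesis using one_side xy by (simp add: clean2_compatible_def)
    next
      case 4
      have "mutually_maximally_distant x y \<longleftrightarrow> mutually_maximally_distant y x"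
        using mmd_sym[OF xy(1,2)] mmd_sym[OF xy(2,1)] by blast
      then show ?thesis using one_side[OF xy(2,1) 4(2,1)] 4
        by (cases "snd x = snd y") (simp_all add: clean2_compatible_def)
    qed
  qed
  have indep: "mmd_independent J \<longleftrightarrow> J \<subseteq> verts ?G \<and> pairwise clean2_compatible J" for J
    by (rule mmd_independent_iff) (rule not_mmd)
  have "sdim ?G + card I = card (verts ?G)"
  proof (rule sdim_plus_card_independent)
    show "mmd_independent I" using I by (simp add: indep verts_clean_graph_2)
    fix J assume "mmd_independent J"
    then show "card J \<le> card I" by (intro max) (simp_all add: indep verts_clean_graph_2)
  qed
  then show ?thesis by (simp add: card_verts_clean_graph_2)
qed

text \<open>The vertex counts differ by the number of units, so only the two maximum cardinalities
  remain to be found.\<close>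

lemma sdim_clean_graph_diff:
  fixes K I :: "('a \<times> 'a) set"
  assumes "2 \<le> card (ring_units :: 'a set)"
    and "K \<subseteq> (idempotents - {0}) \<times> ring_units" "pairwise clean_adjacent K"
    and "\<And>L :: ('a \<times> 'a) set. L \<subseteq> (idempotents - {0}) \<times> ring_units \<Longrightarrow>
      pairwise clean_adjacent L \<Longrightarrow> card L \<le> card K"
    and "I \<subseteq> (idempotents - {0}) \<times> ring_units" "pairwise clean2_compatible I"
    and "\<And>J :: ('a \<times> 'a) set. J \<subseteq> (idempotents - {0}) \<times> ring_units \<Longrightarrow>
      pairwise clean2_compatible J \<Longrightarrow> card J \<le> card I"
  shows "sdim (clean_graph :: ('a \<times> 'a, _) pre_digraph) + card K + 1
    = sdim (clean_graph_2 :: ('a \<times> 'a, _) pre_digraph) + card I + card (ring_units :: 'a set)"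
  using sdim_clean_graph[OF assms(1-4)] sdim_clean_graph_2[OF assms(1,5-7)] by (simp add: algebra_simps)

subsection \<open>Extremal sets\<close>

text \<open>The unit 1 is its own inverse, so the whole slice is a clique; it attains the bound
  \<open>m + 1\<close> in both settings.\<close>

lemma unit_slice:
  defines "K \<equiv> (idempotents - {0 :: 'a}) \<times> {1 :: 'a}"
  shows "K \<subseteq> (idempotents - {0}) \<times> ring_units" "pairwise clean_adjacent K"
    "pairwise clean2_compatible K" "card K = m + 1"
  using card_nonzero_idempotents
  by (auto simp: K_def pairwise_def clean_adjacent_def clean2_compatible_def card_cartesian_product)

text \<open>Different idempotents of \<open>P\<close> are orthogonal, and equal ones come with the
  two inverse units; this attains \<open>2 * N\<close>.\<close>

lemma inverse_pair_slice:
  fixes u v :: 'a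
  assumes "u \<in> noninvolutive_units" "u * v = 1"
  defines "K \<equiv> (P - {0}) \<times> {u, v}"
  shows "K \<subseteq> nontrivial_idempotents \<times> ring_units" "K \<subseteq> (idempotents - {0}) \<times> ring_units"
    "pairwise clean_adjacent K" "finite K" "card K = 2 * N"
proof -
  have "v dvd 1" using assms(2) by (metis dvd_triv_right)
  then have v: "v \<in> ring_units" by (simp add: ring_units_def)
  have "u \<noteq> v" using assms by (auto simp: noninvolutive_units_iff)
  show sub: "K \<subseteq> nontrivial_idempotents \<times> ring_units"
    using P_nontrivial v assms by (auto simp: noninvolutive_units_iff)
  then show "K \<subseteq> (idempotents - {0}) \<times> ring_units"
    by (auto simp: nontrivial_idempotents_def)
  have "e * f = 0" if "e \<in> P" "f \<in> P" "e \<noteq> f" for e f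
    using maximum_P that
    by (auto simp: maximum_orthogonal_idempotents_def orthogonal_idempotents_def pairwise_def)
  then show "pairwise clean_adjacent K"
    using assms(2) by (auto simp: K_def pairwise_def clean_adjacent_def mult.commute)
  show "finite K" using finite_P by (simp add: K_def)
  show "card K = 2 * N"
    using \<open>u \<noteq> v\<close> by (simp add: K_def card_cartesian_product)
qed

lemma ex_maximum_clique:
  assumes "noninvolutive_units \<noteq> ({} :: 'a set)"
  obtains K :: "('a \<times> 'a) set" where "K \<subseteq> (idempotents - {0}) \<times> ring_units"
    "pairwise clean_adjacent K" "card K = max (m + 1) (2 * N)"
proof (cases "m + 1 \<ge> 2 * N")
  case True
  then show ?thesis using that[OF unit_slice(1,2)] unit_slice(4) by simp
next
  case False
  obtain u :: 'a where u: "u \<in> noninvolutive_units" using assms by blast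
  then obtain v where "u * v = 1" using noninvolutive_unit_has_inverse by blast
  note K = inverse_pair_slice[OF u this]
  show ?thesis using that[OF K(2,3)] K(5) False by simp
qed

text \<open>Vertices with idempotent 1 can be added to a clique as long as their units are pairwise
  inverse and no noninvolutive one among them already occurs in the clique.\<close>

lemma compatible_extend:
  fixes K :: "('a \<times> 'a) set"
  assumes K: "K \<subseteq> nontrivial_idempotents \<times> ring_units" "pairwise clean_adjacent K"
    and W: "W \<subseteq> ring_units" "pairwise (\<lambda>u v. u * v = 1) W"
    and KW: "\<And>w. w \<in> W \<Longrightarrow> w \<in> snd ` K \<Longrightarrow> w * w = 1"
  shows "K \<union> {1} \<times> W \<subseteq> (idempotents - {0}) \<times> ring_units"
    "pairwise clean2_compatible (K \<union> {1} \<times> W)" "card (K \<union> {1} \<times> W) = card K + card W"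
proof -
  have not_one: "fst x \<noteq> 1" if "x \<in> K" for x using K(1) that by (auto simp: nontrivial_idempotents_def)
  show "K \<union> {1} \<times> W \<subseteq> (idempotents - {0}) \<times> ring_units"
    using K(1) W(1) by (auto simp: nontrivial_idempotents_def idempotents_def)
  have KK: "clean2_compatible x y" if "x \<in> K" "y \<in> K" "x \<noteq> y" for x y
    using pairwiseD[OF K(2)] that not_one by (simp add: clean2_compatible_def)
  have WW: "clean2_compatible x y" if "x \<in> {1} \<times> W" "y \<in> {1} \<times> W" "x \<noteq> y" for x y
    using that pairwiseD[OF W(2), of "snd x" "snd y"] by (auto simp: clean2_compatible_def)
  have KWc: "clean2_compatible x y \<and> clean2_compatible y x" if "x \<in> K" "y \<in> {1} \<times> W" for x y
    using that not_one[OF that(1)] KW[of "snd y"] by (auto simp: clean2_compatible_def)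
  show "pairwise clean2_compatible (K \<union> {1} \<times> W)"
    unfolding pairwise_def using KK WW KWc by blast
  have "finite K" "finite W"
    using K(1) W(1) finite_nontrivial finite_units by (meson finite_SigmaI finite_subset)+
  moreover have "K \<inter> {1} \<times> W = {}" using not_one by fastforce
  ultimately show "card (K \<union> {1} \<times> W) = card K + card W"
    by (simp add: card_Un_disjoint card_cartesian_product)
qed

lemma nontrivial_unit_slice:
  defines "K \<equiv> (nontrivial_idempotents :: 'a set) \<times> {1 :: 'a}"
  shows "K \<subseteq> nontrivial_idempotents \<times> ring_units" "pairwise clean_adjacent K" "card K = m"
  using card_nontrivial
  by (auto simp: K_def pairwise_def clean_adjacent_def card_cartesian_product)

lemma ex_compatible_nontrivial_unit_slice:
  fixes u v :: 'a
  assumes "u \<in> noninvolutive_units" "v \<in> noninvolutive_units" "u * v = 1" "u \<noteq> v"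
  obtains I :: "('a \<times> 'a) set" where "I \<subseteq> (idempotents - {0}) \<times> ring_units"
    "pairwise clean2_compatible I" "card I = m + 2"
proof -
  have W: "{u, v} \<subseteq> ring_units" "pairwise (\<lambda>u v. u * v = 1) {u, v}"
    using assms by (auto simp: noninvolutive_units_iff pairwise_insert mult.commute)
  have "w * w = 1" if "w \<in> snd ` ((nontrivial_idempotents :: 'a set) \<times> {1 :: 'a})" for w
    using that by (auto split: if_splits)
  note I = compatible_extend[OF nontrivial_unit_slice(1,2) W this]
  show ?thesis using that[OF I(1,2)] I(3) assms(4) nontrivial_unit_slice(3) by auto
qed

lemma ex_maximum_compatible_2:
  assumes "card (noninvolutive_units :: 'a set) = 2"
  obtains I :: "('a \<times> 'a) set" where "I \<subseteq> (idempotents - {0}) \<times> ring_units"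
    "pairwise clean2_compatible I" "card I = max (m + 2) (2 * N + 1)"
proof -
  obtain u :: 'a where u: "u \<in> noninvolutive_units" using assms by fastforce
  then obtain v where v: "v \<in> noninvolutive_units" "u * v = 1" "u \<noteq> v"
    using noninvolutive_unit_has_inverse by blast
  show ?thesis
  proof (cases "m + 2 \<ge> 2 * N + 1")
    case True
    then show ?thesis using ex_compatible_nontrivial_unit_slice[OF u v] that by (metis max.absorb1)
  next
    case False
    note K = inverse_pair_slice[OF u v(2)]
    \<comment> \<open>The slice already uses both noninvolutive units, so only one vertex with an
      involutive unit is added.\<close>
    have "{1 :: 'a} \<subseteq> ring_units" "pairwise (\<lambda>u v :: 'a. u * v = 1) {1}" by auto
    note I = compatible_extend[OF K(1,3) this]
    show ?thesis using that[OF I(1,2)] I(3) K(5) False by simp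
  qed
qed

lemma ex_maximum_compatible:
  assumes "card (noninvolutive_units :: 'a set) > 2"
  obtains I :: "('a \<times> 'a) set" where "I \<subseteq> (idempotents - {0}) \<times> ring_units"
    "pairwise clean2_compatible I" "card I = max m (2 * N) + 2"
proof -
  obtain u :: 'a where u: "u \<in> noninvolutive_units" using assms by fastforce
  then obtain v where v: "v \<in> noninvolutive_units" "u * v = 1" "u \<noteq> v"
    using noninvolutive_unit_has_inverse by blast
  show ?thesis
  proof (cases "m \<ge> 2 * N")
    case True
    then show ?thesis using ex_compatible_nontrivial_unit_slice[OF u v] that by (metis max.absorb1)
  next
    case False
    note K = inverse_pair_slice[OF u v(2)]
    \<comment> \<open>A third noninvolutive unit comes with its inverse, and this fresh pair can be
      added to the slice over \<open>u\<close> and \<open>v\<close>.\<close>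
    have "\<not> noninvolutive_units \<subseteq> {u, v}"
      using assms v(3) card_mono[of "{u, v}" noninvolutive_units] by auto
    then obtain a where a: "a \<in> noninvolutive_units" "a \<noteq> u" "a \<noteq> v" by blast
    then obtain b where b: "b \<in> noninvolutive_units" "a * b = 1" "a \<noteq> b"
      using noninvolutive_unit_has_inverse by blast
    have "b \<noteq> u" "b \<noteq> v"
      using inverse_unique_comm_ring[of u v a] inverse_unique_comm_ring[of v u a] a b v
      by (auto simp: mult.commute)
    have W: "{a, b} \<subseteq> ring_units" "pairwise (\<lambda>u v. u * v = 1) {a, b}"
      using a b by (auto simp: noninvolutive_units_iff pairwise_insert mult.commute)
    have "w * w = 1" if "w \<in> {a, b}" "w \<in> snd ` ((P - {0}) \<times> {u, v})" for w
      using that a \<open>b \<noteq> u\<close> \<open>b \<noteq> v\<close> by (auto split: if_splits)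
    note I = compatible_extend[OF K(1,3) W this]
    show ?thesis using that[OF I(1,2)] I(3) K(5) False b(3) by simp
  qed
qed

section \<open>The cases according to the units\<close>

lemma two_le_card_units:
  assumes "noninvolutive_units \<noteq> ({} :: 'a set)"
  shows "2 \<le> card (ring_units :: 'a set)"
proof -
  obtain u :: 'a where u: "u \<in> noninvolutive_units" using assms by blast
  then have "{1, u} \<subseteq> ring_units" "u \<noteq> 1" by (auto simp: noninvolutive_units_iff)
  then show ?thesis using card_mono[OF finite_units, of "{1, u}"] by simp
qed

text \<open>With 1 as the only unit all vertices are adjacent, so both graphs are complete.\<close>

lemma sdim_one_unit:
  assumes "card (ring_units :: 'a set) = 1"
  shows "sdim (clean_graph :: ('a \<times> 'a, _) pre_digraph) = sdim (clean_graph_2 :: ('a \<times> 'a, _) pre_digraph) + 1"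
proof -
  have "u = 1" if "u \<in> ring_units" for u :: 'a
    using assms one_ring_unit that by (metis card_1_singletonE singletonD)
  then have adj: "clean_adjacent x y" if "snd x \<in> ring_units" "snd y \<in> ring_units" for x y :: "'a \<times> 'a"
    using that by (metis clean_adjacent_def mult_1)
  have ne: "(1, 1) \<in> verts (clean_graph :: ('a \<times> 'a, _) pre_digraph)"
    "(1, 1) \<in> verts (clean_graph_2 :: ('a \<times> 'a, _) pre_digraph)"
    by (simp_all add: verts_clean_graph verts_clean_graph_2 idempotents_def)
  have "sdim (clean_graph :: ('a \<times> 'a, _) pre_digraph) + 1 = m + 2"
    using graph.sdim_complete[OF graph_clean_graph[OF finite_verts_clean_graph]] ne adj
      card_verts_clean_graph assms by (fastforce simp: clean_graph_adj_iff verts_clean_graph)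
  moreover have "sdim (clean_graph_2 :: ('a \<times> 'a, _) pre_digraph) + 1 = m + 1"
    using graph.sdim_complete[OF graph_clean_graph_2[OF finite_verts_clean_graph]] ne adj
      card_verts_clean_graph_2 assms by (fastforce simp: clean_graph_2_adj_iff verts_clean_graph_2)
  ultimately show ?thesis by simp
qed

lemma sdim_involutive_units:
  assumes "2 \<le> card (ring_units :: 'a set)" "noninvolutive_units = ({} :: 'a set)"
  shows "sdim (clean_graph :: ('a \<times> 'a, _) pre_digraph) + 1
    = sdim (clean_graph_2 :: ('a \<times> 'a, _) pre_digraph) + card (ring_units :: 'a set)"
  using sdim_clean_graph_diff[OF assms(1) unit_slice(1,2) _ unit_slice(1,3)]
    clique_card_le(2)[OF _ _ assms(2)] compatible_card_le(2)[OF _ _ assms(2)] unit_slice(4) by simp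

text \<open>The maximum compatible set is exactly one larger than the maximum clique, whichever term
  attains the maximum.\<close>

lemma sdim_two_noninvolutive_units:
  assumes "card (noninvolutive_units :: 'a set) = 2"
  shows "sdim (clean_graph :: ('a \<times> 'a, _) pre_digraph)
    = sdim (clean_graph_2 :: ('a \<times> 'a, _) pre_digraph) + card (ring_units :: 'a set)"
proof -
  have ne: "noninvolutive_units \<noteq> ({} :: 'a set)" using assms by auto
  obtain K :: "('a \<times> 'a) set" where K: "K \<subseteq> (idempotents - {0}) \<times> ring_units"
    "pairwise clean_adjacent K" "card K = max (m + 1) (2 * N)"
    using ex_maximum_clique[OF ne] .
  obtain I :: "('a \<times> 'a) set" where I: "I \<subseteq> (idempotents - {0}) \<times> ring_units"
    "pairwise clean2_compatible I" "card I = max (m + 2) (2 * N + 1)"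
    using ex_maximum_compatible_2[OF assms] .
  show ?thesis
    using sdim_clean_graph_diff[OF two_le_card_units[OF ne] K(1,2) _ I(1,2)]
      clique_card_le(1) compatible_card_le(3)[OF _ _ assms] K(3) I(3) by (simp add: max_def split: if_splits)
qed

text \<open>Both maxima are kept, because their difference depends on whether \<open>2 * N\<close>
  exceeds \<open>m\<close>; this separates the last two cases.\<close>

lemma sdim_many_noninvolutive_units:
  assumes "card (noninvolutive_units :: 'a set) > 2"
  shows "sdim (clean_graph :: ('a \<times> 'a, _) pre_digraph) + max (m + 1) (2 * N)
    = sdim (clean_graph_2 :: ('a \<times> 'a, _) pre_digraph) + max m (2 * N) + 1 + card (ring_units :: 'a set)"
proof -
  have ne: "noninvolutive_units \<noteq> ({} :: 'a set)" using assms by auto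
  obtain K :: "('a \<times> 'a) set" where K: "K \<subseteq> (idempotents - {0}) \<times> ring_units"
    "pairwise clean_adjacent K" "card K = max (m + 1) (2 * N)"
    using ex_maximum_clique[OF ne] .
  obtain I :: "('a \<times> 'a) set" where I: "I \<subseteq> (idempotents - {0}) \<times> ring_units"
    "pairwise clean2_compatible I" "card I = max m (2 * N) + 2"
    using ex_maximum_compatible[OF assms] .
  show ?thesis
    using sdim_clean_graph_diff[OF two_le_card_units[OF ne] K(1,2) _ I(1,2)]
      clique_card_le(1) compatible_card_le(1) K(3) I(3) by simp
qed

end

text \<open>When the two terms of the maximum are equal, cases (iv) and (v) as worded in English
  would overlap with conflicting values. The computation then gives the value of (iv), so (v) is
  stated with the additional condition that the maximum is not \<open>card Id'\<close>.\<close>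

theorem theorem4p3:
  fixes Cl Cl2 :: "('a::comm_ring_1 \<times> 'a, ('a \<times> 'a) \<times> ('a \<times> 'a)) pre_digraph"
    and U U'' Id' :: "'a set"
  defines "Cl \<equiv> clean_graph" and "Cl2 \<equiv> clean_graph_2"
    and "U \<equiv> ring_units" and "U'' \<equiv> noninvolutive_units"
    and "Id' \<equiv> nontrivial_idempotents"
  assumes "Id' \<noteq> {}"
    and "finite (verts Cl)"
  shows "(card U = 1 \<longrightarrow> sdim Cl = sdim Cl2 + 1) \<and>
    (card U \<ge> 2 \<and> U'' = {} \<longrightarrow> sdim Cl = sdim Cl2 + card U - 1) \<and>
    (card U'' = 2 \<longrightarrow> sdim Cl = sdim Cl2 + card U) \<and>
    (\<forall>P :: 'a set. maximum_orthogonal_idempotents P \<and> card U'' > 2 \<and>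
        max (2 * card (P - {0})) (card Id') = card Id' \<longrightarrow>
      sdim Cl = sdim Cl2 + card U) \<and>
    (\<forall>P :: 'a set. maximum_orthogonal_idempotents P \<and> card U'' > 2 \<and>
        max (2 * card (P - {0})) (card Id') = 2 * card (P - {0}) \<and>
        max (2 * card (P - {0})) (card Id') \<noteq> card Id' \<longrightarrow>
      sdim Cl = sdim Cl2 + card U + 1)"
proof -
  \<comment> \<open>Both factors of the vertex set are nonempty, so finiteness of the product passes
    to each of them.\<close>
  have "(1 :: 'a) \<in> idempotents" "(1 :: 'a) \<in> ring_units" by (auto simp: idempotents_def)
  then have fin: "finite (idempotents :: 'a set)" "finite (ring_units :: 'a set)"
    using assms(7) finite_cartesian_productD1 finite_cartesian_productD2
    unfolding Cl_def verts_clean_graph by blast+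
  have ring: "clean_ring P (card Id')" if "maximum_orthogonal_idempotents P" for P :: "'a set"
    using fin assms(6) that unfolding Id'_def by unfold_locales auto
  obtain P0 :: "'a set" where "maximum_orthogonal_idempotents P0"
    using ex_maximum_orthogonal_idempotents[OF fin(1)] .
  note P0 = ring[OF this]
  have many: "sdim Cl + max (card Id' + 1) (2 * card (P - {0}))
      = sdim Cl2 + max (card Id') (2 * card (P - {0})) + 1 + card U"
    if "maximum_orthogonal_idempotents P" "card U'' > 2" for P :: "'a set"
    using clean_ring.sdim_many_noninvolutive_units[OF ring[OF that(1)]] that(2)
    unfolding Cl_def Cl2_def U_def U''_def by blast
  show ?thesis
  proof (intro conjI allI impI)
    show "sdim Cl = sdim Cl2 + 1" if "card U = 1"
      using clean_ring.sdim_one_unit[OF P0] that unfolding Cl_def Cl2_def U_def by blast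
    show "sdim Cl = sdim Cl2 + card U - 1" if "card U \<ge> 2 \<and> U'' = {}"
      using clean_ring.sdim_involutive_units[OF P0] that unfolding Cl_def Cl2_def U_def U''_def
      by (metis add_diff_cancel_right')
    show "sdim Cl = sdim Cl2 + card U" if "card U'' = 2"
      using clean_ring.sdim_two_noninvolutive_units[OF P0] that
      unfolding Cl_def Cl2_def U_def U''_def by blast
    show "sdim Cl = sdim Cl2 + card U"
      if "maximum_orthogonal_idempotents P \<and> card U'' > 2 \<and>
        max (2 * card (P - {0})) (card Id') = card Id'" for P :: "'a set"
      using many[of P] that by (simp add: max_def split: if_splits)
    show "sdim Cl = sdim Cl2 + card U + 1"
      if "maximum_orthogonal_idempotents P \<and> card U'' > 2 \<and>
        max (2 * card (P - {0})) (card Id') = 2 * card (P - {0}) \<and>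
        max (2 * card (P - {0})) (card Id') \<noteq> card Id'" for P :: "'a set"
      using many[of P] that by (simp add: max_def split: if_splits)
  qed
qed

end
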